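(* Let $k\ge2$ be an integer, $z\in\mathbb{C}$, $\mathbf{s}=(s_1,\dots,s_k)\in\mathbb{N}^k$, and let $\chi$ be a primitive Dirichlet character. Then the special 1-MTLV $L_{MT}(s_1,\dots,s_k,z;\mathbf 1,\dots,\mathbf 1,\chi)$ is a $\mathbb{Q}$-linear combination of special 1-MLVs of the same weight and the same depth and of the same character type, namely with $\chi$ attached to the (complex) leading variable and principal characters attached to all other variables.
   Context: $\mathbf 1$ denotes the principal character. $L_{MT}(s_1,\dots,s_{k+1};\chi_1,\dots,\chi_{k+1})=\sum_{m_1,\dots,m_k\ge1}\frac{\chi_1(m_1)\cdots\chi_k(m_k)\chi_{k+1}(m_1+\dots+m_k)}{m_1^{s_1}\cdots m_k^{s_k}(m_1+\dots+m_k)^{s_{k+1}}}$ (meromorphically continued), of depth $k$ and weight $s_1+\dots+s_{k+1}$. A special 1-MTLV is such a value with $s_1,\dots,s_k$ positive integers and only $s_{k+1}$ allowed to be complex. Multiple $L$-values are $L(w_1,\dots,w_k;\psi_1,\dots,\psi_k)=\sum_{m_1>\dots>m_k\ge1}\prod_{j}\psi_j(m_j)m_j^{-w_j}$ (depth $k$, weight $w_1+\dots+w_k$); a special 1-MLV is such a value in which $w_2,\dots,w_k$ are positive integers and only the leading variable $w_1$ may be complex. *)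

theory Defs
  imports "HOL-Complex_Analysis.Complex_Analysis"
begin

definition dirichlet_char :: "nat \<Rightarrow> (nat \<Rightarrow> complex) \<Rightarrow> bool" where
  "dirichlet_char q chi \<longleftrightarrow> q > 0 \<and>
     (\<forall>n. chi (n + q) = chi n) \<and>
     (\<forall>m n. chi (m * n) = chi m * chi n) \<and>
     (\<forall>n. chi n \<noteq> 0 \<longleftrightarrow> coprime n q)"

definition primitive_dirichlet_char :: "nat \<Rightarrow> (nat \<Rightarrow> complex) \<Rightarrow> bool" where
  "primitive_dirichlet_char q chi \<longleftrightarrow> dirichlet_char q chi \<and>
     \<not> (\<exists>d chi'. d dvd q \<and> d < q \<and> dirichlet_char d chi' \<and>
            (\<forall>n. coprime n q \<longrightarrow> chi n = chi' n))"

text \<open>The principal character is the one of modulus 1.\<close>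

definition principal_char :: "nat \<Rightarrow> complex" where
  "principal_char = (\<lambda>_. 1)"

text \<open>
  Meromorphic continuation to the whole plane of a function given on some right half-plane.
  The predicate \<^const>\<open>nicely_meromorphic_on\<close> requires the value at a removable singularity to be
  the limit and the value at a pole to be 0, so there is at most one such continuation.
\<close>

definition mero_continuation :: "(complex \<Rightarrow> complex) \<Rightarrow> complex \<Rightarrow> complex" where
  "mero_continuation f =
     (THE g. g nicely_meromorphic_on UNIV \<and> (\<exists>\<sigma>::real. \<forall>u. Re u > \<sigma> \<longrightarrow> g u = f u))"

text \<open>
  Both series take a list of exponents and a list of characters of the same length. The
  Mordell--Tornheim series of depth \<open>k\<close> takes lists of length \<open>k + 1\<close>, whose last entries
  belong to \<open>m\<^sub>1 + \<dots> + m\<^sub>k\<close>. List positions are counted from 0.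
\<close>

definition MTLV_series :: "complex list \<Rightarrow> (nat \<Rightarrow> complex) list \<Rightarrow> complex" where
  "MTLV_series s chi =
     (\<Sum>\<^sub>\<infinity>m \<in> {m :: nat list. length m = length s - 1 \<and> (\<forall>i < length m. m ! i \<ge> 1)}.
        (\<Prod>i < length m. (chi ! i) (m ! i) / of_nat (m ! i) powr (s ! i)) *
        (last chi (sum_list m) / of_nat (sum_list m) powr last s))"

definition MLV_series :: "complex list \<Rightarrow> (nat \<Rightarrow> complex) list \<Rightarrow> complex" where
  "MLV_series w \<psi> =
     (\<Sum>\<^sub>\<infinity>m \<in> {m :: nat list. length m = length w \<and> sorted_wrt (>) m \<and> (\<forall>i < length m. m ! i \<ge> 1)}.
        \<Prod>j < length m. (\<psi> ! j) (m ! j) / of_nat (m ! j) powr (w ! j))"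

text \<open>
  Special values: all exponents but one are positive integers, and the series is continued in the
  remaining complex one, namely the last one for Mordell--Tornheim values (the exponent of
  \<open>m\<^sub>1 + \<dots> + m\<^sub>k\<close>) and the leading one for multiple L-values (the exponent of the largest
  summation variable). As the other exponents are at least 1, the series converge absolutely
  for \<open>Re u > 0\<close> and \<open>Re u > 1\<close> respectively.
\<close>

definition special_MTLV :: "nat list \<Rightarrow> complex \<Rightarrow> (nat \<Rightarrow> complex) list \<Rightarrow> complex" where
  "special_MTLV s z chi = mero_continuation (\<lambda>u. MTLV_series (map of_nat s @ [u]) chi) z"

definition special_MLV :: "complex \<Rightarrow> nat list \<Rightarrow> (nat \<Rightarrow> complex) list \<Rightarrow> complex" where
  "special_MLV w\<^sub>1 w \<psi> = mero_continuation (\<lambda>u. MLV_series (u # map of_nat w) \<psi>) w\<^sub>1"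

end

theory Submission
  imports Defs
begin

text \<open>
  Sorting the terms by \<open>N = m\<^sub>1 + \<dots> + m\<^sub>k\<close> (resp. by the largest variable \<open>N\<close>) makes both
  kinds of values Dirichlet series \<open>\<Sum>\<^sub>N \<chi>(N) a(N) N\<^bsup>-u\<^esup>\<close> with \<open>a\<close> given by finite sums, so the
  identity reduces to one between arithmetic functions. On the Mordell--Tornheim side
  \<open>a(N)\<close> is the coefficient of \<open>X\<^sup>N\<close> in \<open>\<Prod>\<^sub>i Li\<^bsub>s_i\<^esub>(X)\<close>; the
  derivation \<open>X d/dX\<close> multiplies it by \<open>N\<close> and lowers one \<open>s\<^sub>i\<close> at a time, and once some exponent
  is 0 the factor \<open>Li\<^sub>0 = X/(1 - X)\<close> turns coefficients into partial sums, which creates the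
  nested sums of the multiple L-values.

  The continuation comes from periodicity. If \<open>b(n) = a(n + q) - a(n)\<close>, comparing
  \<open>\<Sum> a(n + q)(n + q)\<^bsup>-u\<^esup>\<close> with \<open>\<Sum> a(n) n\<^bsup>-u\<^esup>\<close> and expanding \<open>(n + q)\<^bsup>-u\<^esup>\<close> binomially expresses
  \<open>D(a, u + 1)\<close> through the values \<open>D(a, u + j)\<close> with \<open>j \<ge> 2\<close> and the series of \<open>b\<close>, which moves the
  boundary of continuation one unit to the left. For \<open>\<chi>\<close> times a multiple harmonic sum, \<open>b\<close> has
  smaller depth.
\<close>

subsection \<open>Dirichlet series with shifted arguments\<close>

text \<open>The term for \<open>n = 0\<close> vanishes, as \<open>0 powr w = 0\<close>.\<close>

definition dseries :: "(nat \<Rightarrow> complex) \<Rightarrow> complex \<Rightarrow> complex" where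
  "dseries a u = (\<Sum>n. a n * of_nat n powr (-u))"

text \<open>The value at 0 is left free because the term for \<open>n = 0\<close> of a
  \<open>dseries\<close> always vanishes. The exponent \<open>p\<close> will be the depth of a
  multiple harmonic sum.\<close>

definition power_bounded :: "nat \<Rightarrow> (nat \<Rightarrow> complex) \<Rightarrow> bool" where
  "power_bounded p a \<longleftrightarrow> (\<exists>C. \<forall>n\<ge>1. norm (a n) \<le> C * real n ^ p)"

lemma power_boundedE:
  assumes "power_bounded p a"
  obtains C where "C \<ge> 0" "\<And>n. n \<ge> 1 \<Longrightarrow> norm (a n) \<le> C * real n ^ p"
proof -
  from assms obtain C where C: "\<And>n. n \<ge> 1 \<Longrightarrow> norm (a n) \<le> C * real n ^ p"
    unfolding power_bounded_def by blast
  moreover have "C \<ge> 0"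
    using C[of 1] norm_ge_zero[of "a 1"] by (simp del: norm_ge_zero)
  ultimately show ?thesis using that by blast
qed

lemma norm_power_bounded_term_le:
  assumes "n \<ge> 1" "norm (a n) \<le> C * real n ^ p" "C \<ge> 0" "Re u \<ge> r"
  shows "norm (a n * of_nat n powr (-u)) \<le> C * real n powr (real p - r)"
proof -
  have "norm (of_nat n powr (-u)) = real n powr (- Re u)"
    using norm_powr_real_powr[of "of_nat n" "-u"] by simp
  also have "\<dots> \<le> real n powr (-r)"
    using assms by (intro powr_mono) auto
  finally have "norm (a n * of_nat n powr (-u)) \<le> (C * real n ^ p) * real n powr (-r)"
    unfolding norm_mult using assms by (intro mult_mono) auto
  also have "real n ^ p = real n powr (real p)"
    using assms by (simp add: powr_realpow)
  finally show ?thesis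
    by (simp add: powr_diff powr_minus field_simps)
qed

lemma norm_summable_dseries:
  assumes "power_bounded p a" "Re u > real p + 1"
  shows "summable (\<lambda>n. norm (a n * of_nat n powr (-u)))"
proof -
  obtain C where C: "C \<ge> 0" "\<And>n. n \<ge> 1 \<Longrightarrow> norm (a n) \<le> C * real n ^ p"
    using power_boundedE[OF assms(1)] by blast
  have "summable (\<lambda>n. C * real n powr (real p - Re u))"
    using assms(2) by (intro summable_mult) (simp add: summable_real_powr_iff)
  moreover have "norm (a n * of_nat n powr (-u)) \<le> C * real n powr (real p - Re u)" for n
    using norm_power_bounded_term_le[of n a C p "Re u" u] C by (cases "n = 0") auto
  ultimately show ?thesis
    by (intro summable_comparison_test'[of _ 0 "\<lambda>n. norm (a n * of_nat n powr (-u))"])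
      (simp_all only: real_norm_def abs_norm_cancel)
qed

text \<open>Each factor of the numerator satisfies |u - i| <= B + i = |-B - i|, so the coefficients
  belonging to \<open>-B\<close> dominate uniformly on the disc of radius \<open>B\<close>.\<close>

lemma norm_gbinomial_le:
  fixes u :: complex
  assumes "norm u \<le> B"
  shows "norm (u gchoose j) \<le> norm ((-B) gchoose j)"
proof -
  have B: "B \<ge> 0" using assms norm_ge_zero order_trans by blast
  have "norm (\<Prod>i=0..<j. u - of_nat i) \<le> (\<Prod>i=0..<j. B + real i)"
    unfolding prod_norm[symmetric]
  proof (rule prod_mono)
    fix i show "0 \<le> norm (u - of_nat i) \<and> norm (u - of_nat i) \<le> B + real i"
      using norm_triangle_ineq4[of u "of_nat i"] assms by simp
  qed
  also have "\<dots> = norm (\<Prod>i=0..<j. -B - real i)"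
    unfolding prod_norm[symmetric] by (intro prod.cong) (use B in auto)
  finally show ?thesis
    unfolding gbinomial_prod_rev by (simp add: norm_divide divide_right_mono)
qed

text \<open>After pulling x^J out of the tail of the binomial series, what remains is majorised by
  its value at \<open>B\<close> and 1/2, a point inside the disc of convergence. The constant is
  uniform in \<open>u\<close> and \<open>x\<close>, as locally uniform convergence will
  require.\<close>

lemma binomial_series_remainder_bound:
  "\<exists>M\<ge>0. \<forall>(u::complex) x. norm u \<le> B \<longrightarrow> norm x \<le> 1/2 \<longrightarrow>
     norm ((1 + x) powr u - (\<Sum>j<J. (u gchoose j) * x ^ j)) \<le> M * norm x ^ J"
proof -
  define c where "c = (\<lambda>j. norm ((-B) gchoose j))"
  have "ereal (norm (1/2::real)) < conv_radius (\<lambda>n. (-B) gchoose n)"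
    by (auto simp: conv_radius_gchoose)
  from abs_summable_in_conv_radius[OF this]
  have "summable (\<lambda>j. c j * (1/2)^j)" by (simp add: c_def abs_mult)
  hence "summable (\<lambda>j. c (j+J) * (1/2)^(j+J))" by (subst summable_iff_shift)
  hence "summable (\<lambda>j. (c (j+J) * (1/2)^(j+J)) * 2^J)" by (rule summable_mult2)
  hence summ: "summable (\<lambda>j. c (j+J) * (1/2)^j)"
    by (simp add: power_add field_simps)
  define M where "M = (\<Sum>j. c (j+J) * (1/2)^j)"
  have "norm ((1 + x) powr u - (\<Sum>j<J. (u gchoose j) * x ^ j)) \<le> M * norm x ^ J"
    if u: "norm u \<le> B" and x: "norm x \<le> 1/2" for u x :: complex
  proof -
    have "(\<lambda>j. (u gchoose j) * x^j) sums (1 + x) powr u"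
      using x by (intro gen_binomial_complex) auto
    hence eq: "(\<lambda>j. (u gchoose (j+J)) * x^(j+J)) sums
        ((1 + x) powr u - (\<Sum>j<J. (u gchoose j) * x ^ j))"
      by (subst sums_iff_shift) simp
    have le: "norm ((u gchoose (j+J)) * x^(j+J)) \<le> norm x ^ J * (c (j+J) * (1/2)^j)" for j
    proof -
      have "norm ((u gchoose (j+J)) * x^(j+J)) = norm (u gchoose (j+J)) * norm x^j * norm x^J"
        by (simp add: norm_mult norm_power power_add)
      also have "\<dots> \<le> c (j+J) * (1/2)^j * norm x^J"
        using u x unfolding c_def
        by (intro mult_mono norm_gbinomial_le power_mono) auto
      finally show ?thesis by (simp add: mult_ac)
    qed
    have s2: "summable (\<lambda>j. norm x ^ J * (c (j+J) * (1/2)^j))" using summ by (rule summable_mult)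
    have "norm (\<Sum>j. (u gchoose (j+J)) * x^(j+J)) \<le> (\<Sum>j. norm x ^ J * (c (j+J) * (1/2)^j))"
      using le s2 by (rule norm_suminf_le)
    thus ?thesis
      using eq summ by (simp add: sums_iff M_def suminf_mult mult_ac)
  qed
  moreover have "M \<ge> 0"
    unfolding M_def by (rule suminf_nonneg[OF summ]) (auto simp: c_def)
  ultimately show ?thesis by blast
qed

text \<open>For n > 2|t| one has (n + t)^(-u) = n^(-u) (1 + t/n)^(-u). The first \<open>J\<close>
  binomial terms give the values D(a, u + j); the remainders are of order n^(p - Re u - J), so their
  sum is holomorphic \<open>J\<close> units further to the left. The vanishing hypothesis discards
  the \<open>n\<close> with |t/n| > 1/2 and also \<open>n = 0\<close>. With \<open>J = 0\<close> the
  lemma is just convergence and holomorphy.\<close>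

lemma shifted_dseries_expansion:
  assumes bd: "power_bounded p a" and z: "\<And>n. real n \<le> 2 * \<bar>t\<bar> \<Longrightarrow> a n = 0"
  obtains R where "R holomorphic_on {u. Re u > real p + 1 - real J}"
    "\<forall>u. Re u > real p + 1 \<longrightarrow> (\<lambda>n. a n * of_real (real n + t) powr (-u)) sums
        ((\<Sum>j<J. ((-u) gchoose j) * of_real t ^ j * dseries a (u + of_nat j)) + R u)"
proof -
  define S where "S = {u. Re u > real p + 1 - real J}"
  have [simp]: "open S" unfolding S_def by (rule open_halfspace_Re_gt)
  define r where "r = (\<lambda>n u. a n * (of_real (real n + t) powr (-u) - 
      (\<Sum>j<J. ((-u) gchoose j) * of_real t ^ j * of_nat n powr (-(u + of_nat j)))))"
  obtain C where C: "C \<ge> 0" "\<And>n. n \<ge> 1 \<Longrightarrow> norm (a n) \<le> C * real n ^ p"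
    using power_boundedE[OF bd] by blast
  have r_eq: "r n u = a n * of_nat n powr (-u) *
     ((1 + of_real (t / n)) powr (-u) - (\<Sum>j<J. ((-u) gchoose j) * of_real (t / n) ^ j))"
    and t_small: "\<bar>t / n\<bar> \<le> 1/2" if n: "real n > 2 * \<bar>t\<bar>" for n u
  proof -
    from n have n0: "n > 0" by (cases n) auto
    show "\<bar>t / n\<bar> \<le> 1/2" using n n0 by (simp add: field_simps)
    have "of_real (real n + t) powr (-u) = (of_nat n * of_real (1 + t / n)) powr (-u)"
      using n0 by (simp add: distrib_left)
    also have "\<dots> = of_nat n powr (-u) * of_real (1 + t / n) powr (-u)"
    proof (rule powr_times_real)
      show "0 \<le> Re (complex_of_real (1 + t / real n))"
        using n n0 by (simp add: field_simps)
    qed auto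
    finally have e1: "of_real (real n + t) powr (-u) =
        of_nat n powr (-u) * (1 + of_real (t / n)) powr (-u)" by simp
    have e2: "of_real t ^ j * of_nat n powr (-(u + of_nat j)) =
         of_nat n powr (-u) * of_real (t / n) ^ j" for j
      using n0 by (simp add: powr_diff power_divide powr_nat')
    show "r n u = a n * of_nat n powr (-u) *
     ((1 + of_real (t / n)) powr (-u) - (\<Sum>j<J. ((-u) gchoose j) * of_real (t / n) ^ j))"
      unfolding r_def e1 mult.assoc e2
      by (simp add: sum_distrib_left algebra_simps)
  qed
  have hol: "r n field_differentiable (at u)" for n u
  proof -
    have "r n holomorphic_on UNIV"
      unfolding r_def gbinomial_prod_rev by (intro holomorphic_intros) auto
    thus ?thesis using holomorphic_on_imp_differentiable_at by blast
  qed
  \<comment> \<open>The comparison test used below expects, near each point, a summable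
    complex-valued majorant taking values in the nonnegative reals.\<close>
  have bound: "\<exists>d h. 0 < d \<and> summable h \<and> range h \<subseteq> \<real>\<^sub>\<ge>\<^sub>0 \<and>
     (\<forall>\<^sub>F n in sequentially. \<forall>y\<in>ball x d \<inter> S. norm (r n y) \<le> norm (h n :: complex))"
    if x: "x \<in> S" for x
  proof -
    \<comment> \<open>Half the distance from \<open>x\<close> to the boundary line: on the ball of
      this radius the real part stays above \<open>\<rho>\<close>, still strictly inside the
      half-plane.\<close>
    define d where "d = (Re x - (real p + 1 - real J)) / 2"
    have d: "d > 0" using x by (simp add: d_def S_def)
    define \<rho> where "\<rho> = Re x - d"
    have \<rho>: "\<rho> > real p + 1 - real J" using x by (simp add: \<rho>_def d_def S_def field_simps)
    obtain M where M: "M \<ge> 0" "\<And>u y. norm (u::complex) \<le> norm x + d \<Longrightarrow> norm y \<le> 1/2 \<Longrightarrow>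
       norm ((1 + y) powr u - (\<Sum>j<J. (u gchoose j) * y ^ j)) \<le> M * norm y ^ J"
      using binomial_series_remainder_bound[of "norm x + d" J] by blast
    define h where "h = (\<lambda>n. (C * M * \<bar>t\<bar> ^ J) * real n powr (real p - \<rho> - real J))"
    have hn: "h n \<ge> 0" for n using C M by (simp add: h_def)
    have le: "norm (r n y) \<le> h n" if y: "y \<in> ball x d \<inter> S" for n y
    proof (cases "real n > 2 * \<bar>t\<bar>")
      case False
      thus ?thesis using z[of n] hn[of n] by (simp add: r_def)
    next
      case True
      hence n0: "n \<ge> 1" by (cases n) auto
      have 1: "Re y \<ge> \<rho>" 
        using y abs_Re_le_cmod[of "x - y"] by (auto simp: \<rho>_def dist_norm)
      have 2: "norm (-y) \<le> norm x + d"
        using y norm_triangle_ineq2[of y x] by (auto simp: dist_norm norm_minus_commute)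
      have 3: "norm (complex_of_real (t / n)) \<le> 1/2"
        using t_small[OF True] unfolding norm_of_real .
      have "norm (r n y) \<le> (C * real n powr (real p - \<rho>)) * (M * norm (complex_of_real (t / n)) ^ J)"
        unfolding r_eq[OF True] norm_mult[of "a n * of_nat n powr (-y)"]
        by (rule mult_mono[OF norm_power_bounded_term_le M(2)])
          (use n0 C 1 2 3 in auto)
      also have "\<dots> = h n"
        using n0 by (simp add: h_def powr_diff power_divide powr_realpow norm_divide norm_mult)
      finally show ?thesis .
    qed
    have "summable h" unfolding h_def
      using \<rho> by (intro summable_mult) (simp add: summable_real_powr_iff)
    hence "summable (\<lambda>n. complex_of_real (h n))" by (rule summable_of_real)
    moreover have "range (\<lambda>n. complex_of_real (h n)) \<subseteq> \<real>\<^sub>\<ge>\<^sub>0" using hn by auto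
    moreover have "\<forall>\<^sub>F n in sequentially. \<forall>y\<in>ball x d \<inter> S. norm (r n y) \<le> norm (complex_of_real (h n))"
      using le hn by (intro always_eventually) auto
    ultimately show ?thesis using d by blast
  qed
  obtain R where R: "\<forall>x\<in>S. ((\<lambda>n. r n x) sums R x) \<and> R field_differentiable (at x)"
    using series_differentiable_comparison_complex[of S r, OF _ hol bound] by auto
  show ?thesis
  proof (rule that)
    show "R holomorphic_on {u. Re u > real p + 1 - real J}"
      using R unfolding S_def by (auto simp: holomorphic_on_def field_differentiable_at_within)
  next
    show "\<forall>u. Re u > real p + 1 \<longrightarrow> (\<lambda>n. a n * of_real (real n + t) powr (-u)) sums
        ((\<Sum>j<J. ((-u) gchoose j) * of_real t ^ j * dseries a (u + of_nat j)) + R u)"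
    proof (intro allI impI)
      fix u assume u: "Re u > real p + 1"
      have "(\<lambda>n. a n * of_nat n powr (-(u + of_nat j))) sums dseries a (u + of_nat j)" for j
        unfolding dseries_def
        by (intro summable_sums summable_norm_cancel[OF norm_summable_dseries[OF bd]]) (use u in auto)
      hence "(\<lambda>n. (\<Sum>j<J. ((-u) gchoose j) * of_real t ^ j * (a n * of_nat n powr (-(u + of_nat j)))))
         sums (\<Sum>j<J. ((-u) gchoose j) * of_real t ^ j * dseries a (u + of_nat j))"
        by (intro sums_sum sums_mult)
      moreover have "(\<lambda>n. r n u) sums R u" using R u by (auto simp: S_def)
      ultimately have "(\<lambda>n. (\<Sum>j<J. ((-u) gchoose j) * of_real t ^ j * (a n * of_nat n powr (-(u + of_nat j)))) + r n u)
         sums ((\<Sum>j<J. ((-u) gchoose j) * of_real t ^ j * dseries a (u + of_nat j)) + R u)"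
        by (rule sums_add)
      also have "(\<lambda>n. (\<Sum>j<J. ((-u) gchoose j) * of_real t ^ j * (a n * of_nat n powr (-(u + of_nat j)))) + r n u)
          = (\<lambda>n. a n * of_real (real n + t) powr (-u))"
        by (simp add: r_def sum_distrib_left algebra_simps)
      finally show "(\<lambda>n. a n * of_real (real n + t) powr (-u)) sums
         ((\<Sum>j<J. ((-u) gchoose j) * of_real t ^ j * dseries a (u + of_nat j)) + R u)" .
    qed
  qed
qed

subsection \<open>Meromorphic continuation of Dirichlet series\<close>

text \<open>Only the values of \<open>f\<close> far to the right count, so the arbitrary value of
  \<open>dseries\<close> at a divergent series does no harm. The extension may still take wrong
  values at isolated points; these are repaired in \<open>merom_ext_glue\<close>.\<close>

definition merom_ext :: "real \<Rightarrow> (complex \<Rightarrow> complex) \<Rightarrow> bool" where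
  "merom_ext \<sigma> f \<longleftrightarrow>
     (\<exists>g. g meromorphic_on {u. Re u > \<sigma>} \<and> (\<exists>\<rho>. \<forall>u. Re u > \<rho> \<longrightarrow> g u = f u))"

lemma merom_ext_cong:
  assumes "merom_ext \<sigma> f" "\<And>u. Re u > \<rho> \<Longrightarrow> f' u = f u"
  shows "merom_ext \<sigma> f'"
proof -
  obtain g r where g: "g meromorphic_on {u. Re u > \<sigma>}" "\<And>u. Re u > r \<Longrightarrow> g u = f u"
    using assms(1) unfolding merom_ext_def by blast
  have "\<forall>u. Re u > max r \<rho> \<longrightarrow> g u = f' u" using g assms(2) by auto
  thus ?thesis using g unfolding merom_ext_def by blast
qed

lemma merom_extI:
  assumes "f meromorphic_on {u. Re u > \<sigma>}"
  shows "merom_ext \<sigma> f"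
  using assms unfolding merom_ext_def by blast

lemma merom_ext_mono:
  assumes "merom_ext \<sigma> f" "\<sigma> \<le> \<sigma>'"
  shows "merom_ext \<sigma>' f"
proof -
  have "{u. Re u > \<sigma>'} \<subseteq> {u. Re u > \<sigma>}" using assms(2) by auto
  thus ?thesis using assms(1) meromorphic_on_subset unfolding merom_ext_def by blast
qed

lemma merom_ext_add:
  assumes "merom_ext \<sigma> f" "merom_ext \<sigma> g"
  shows "merom_ext \<sigma> (\<lambda>u. f u + g u)"
proof -
  obtain f' r where f: "f' meromorphic_on {u. Re u > \<sigma>}" "\<And>u. Re u > r \<Longrightarrow> f' u = f u"
    using assms(1) unfolding merom_ext_def by blast
  obtain g' r' where g: "g' meromorphic_on {u. Re u > \<sigma>}" "\<And>u. Re u > r' \<Longrightarrow> g' u = g u"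
    using assms(2) unfolding merom_ext_def by blast
  have "(\<lambda>u. f' u + g' u) meromorphic_on {u. Re u > \<sigma>}"
    using f g by (intro meromorphic_intros)
  moreover have "\<forall>u. Re u > max r r' \<longrightarrow> f' u + g' u = f u + g u" using f g by auto
  ultimately show ?thesis unfolding merom_ext_def by (intro exI conjI)
qed

lemma merom_ext_mult:
  assumes "merom_ext \<sigma> f" "merom_ext \<sigma> g"
  shows "merom_ext \<sigma> (\<lambda>u. f u * g u)"
proof -
  obtain f' r where f: "f' meromorphic_on {u. Re u > \<sigma>}" "\<And>u. Re u > r \<Longrightarrow> f' u = f u"
    using assms(1) unfolding merom_ext_def by blast
  obtain g' r' where g: "g' meromorphic_on {u. Re u > \<sigma>}" "\<And>u. Re u > r' \<Longrightarrow> g' u = g u"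
    using assms(2) unfolding merom_ext_def by blast
  have "(\<lambda>u. f' u * g' u) meromorphic_on {u. Re u > \<sigma>}"
    using f g by (intro meromorphic_intros)
  moreover have "\<forall>u. Re u > max r r' \<longrightarrow> f' u * g' u = f u * g u" using f g by auto
  ultimately show ?thesis unfolding merom_ext_def by (intro exI conjI)
qed

lemma merom_ext_const: "merom_ext \<sigma> (\<lambda>_. c)"
  by (intro merom_extI meromorphic_intros)

lemma merom_ext_sum:
  assumes "\<And>i. i \<in> I \<Longrightarrow> merom_ext \<sigma> (f i)"
  shows "merom_ext \<sigma> (\<lambda>u. \<Sum>i\<in>I. f i u)"
  using assms
  by (induction I rule: infinite_finite_induct) (auto intro!: merom_ext_add merom_ext_const)

lemma merom_ext_translate:
  assumes "merom_ext \<sigma> f" "\<sigma> - c \<le> \<tau>"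
  shows "merom_ext \<tau> (\<lambda>u. f (u + of_real c))"
proof -
  obtain f' r where f: "f' meromorphic_on {u. Re u > \<sigma>}" "\<And>u. Re u > r \<Longrightarrow> f' u = f u"
    using assms(1) unfolding merom_ext_def by blast
  have "(\<lambda>u. f' (u + of_real c)) meromorphic_on {u. Re u > \<tau>}"
    by (rule meromorphic_on_compose[OF f(1)]) (use assms(2) in \<open>auto intro!: analytic_intros\<close>)
  moreover have "\<forall>u. Re u > r - c \<longrightarrow> f' (u + of_real c) = f (u + of_real c)" using f by auto
  ultimately show ?thesis unfolding merom_ext_def by (intro exI conjI)
qed

lemma merom_ext_gbinomial: "merom_ext \<sigma> (\<lambda>u. (-u) gchoose j)"
  unfolding gbinomial_prod_rev by (intro merom_extI meromorphic_intros)

text \<open>One extension per half-plane, possibly a different one each time. This suits an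
  induction that moves the boundary to the left; a single function is assembled only in
  \<open>merom_ext_glue\<close>.\<close>

definition merom_dseries :: "(nat \<Rightarrow> complex) \<Rightarrow> bool" where
  "merom_dseries a \<longleftrightarrow> (\<forall>\<sigma>. merom_ext \<sigma> (dseries a))"

lemma dseries_sums:
  assumes "power_bounded p a" "Re u > real p + 1"
  shows "(\<lambda>n. a n * of_nat n powr (-u)) sums dseries a u"
  unfolding dseries_def
  by (intro summable_sums summable_norm_cancel[OF norm_summable_dseries[OF assms]])

text \<open>Changing finitely many coefficients adds a Dirichlet polynomial, which is entire. This
  is how the initial coefficients are cleared before applying
  \<open>shifted_dseries_expansion\<close>.\<close>

lemma merom_dseries_cofinite:
  assumes "merom_dseries a" "power_bounded p a" "\<And>n. n \<ge> N \<Longrightarrow> a' n = a n"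
  shows "merom_dseries a'"
  unfolding merom_dseries_def
proof
  fix \<sigma>
  have "merom_ext \<sigma> (\<lambda>u. dseries a u + (\<Sum>n\<in>{1..<N}. (a' n - a n) * of_nat n powr (-u)))"
  proof (rule merom_ext_add)
    show "merom_ext \<sigma> (dseries a)" using assms(1) unfolding merom_dseries_def by blast
    show "merom_ext \<sigma> (\<lambda>u. \<Sum>n = 1..<N. (a' n - a n) * of_nat n powr (-u))"
      by (intro merom_ext_sum merom_extI analytic_on_imp_meromorphic_on analytic_intros) auto
  qed
  thus "merom_ext \<sigma> (dseries a')"
  proof (rule merom_ext_cong[where \<rho> = "real p + 1"])
    fix u assume u: "Re u > real p + 1"
    have "(\<lambda>n. (a' n - a n) * of_nat n powr (-u)) sums
        (\<Sum>n\<in>{1..<N}. (a' n - a n) * of_nat n powr (-u))"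
      by (rule sums_finite) (use assms(3) in \<open>auto simp: not_less Suc_le_eq\<close>)
    from sums_add[OF dseries_sums[OF assms(2) u] this]
    show "dseries a' u = dseries a u + (\<Sum>n\<in>{1..<N}. (a' n - a n) * of_nat n powr (-u))"
      by (simp add: dseries_def algebra_simps sums_iff)
  qed
qed

section \<open>Growth bounds for coefficients\<close>

lemma power_bounded_comparison:
  assumes "power_bounded p a" "\<And>n. n \<ge> 1 \<Longrightarrow> norm (b n) \<le> norm (a n)"
  shows "power_bounded p b"
  using assms unfolding power_bounded_def by (meson order_trans)

lemma power_bounded_add:
  assumes "power_bounded p a" "power_bounded p b"
  shows "power_bounded p (\<lambda>n. a n + b n)"
proof -
  obtain A B where "\<And>n. n \<ge> 1 \<Longrightarrow> norm (a n) \<le> A * real n ^ p"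
    "\<And>n. n \<ge> 1 \<Longrightarrow> norm (b n) \<le> B * real n ^ p"
    using assms unfolding power_bounded_def by blast
  hence "\<forall>n\<ge>1. norm (a n + b n) \<le> (A + B) * real n ^ p"
    by (auto simp: distrib_right intro!: norm_triangle_le add_mono)
  thus ?thesis unfolding power_bounded_def by blast
qed

lemma power_bounded_sum:
  assumes "\<And>i. i \<in> I \<Longrightarrow> power_bounded p (a i)"
  shows "power_bounded p (\<lambda>n. \<Sum>i\<in>I. a i n)"
  using assms
proof (induction I rule: infinite_finite_induct)
  case (insert x F)
  thus ?case by (auto intro!: power_bounded_add)
qed (auto simp: power_bounded_def intro!: exI[of _ 0])

lemma power_bounded_shift:
  assumes "power_bounded p a"
  shows "power_bounded p (\<lambda>n. a (n + i))"
proof -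
  obtain C where C: "C \<ge> 0" "\<And>n. n \<ge> 1 \<Longrightarrow> norm (a n) \<le> C * real n ^ p"
    using power_boundedE[OF assms] by blast
  have "norm (a (n + i)) \<le> (C * real (i + 1) ^ p) * real n ^ p" if "n \<ge> 1" for n
  proof -
    have "norm (a (n + i)) \<le> C * real (n + i) ^ p" by (rule C(2)) (use that in simp)
    also have "real (n + i) \<le> real ((i + 1) * n)"
      unfolding of_nat_le_iff using that by (simp add: algebra_simps)
    hence "C * real (n + i) ^ p \<le> C * real ((i + 1) * n) ^ p"
      by (intro mult_left_mono power_mono) (use C in auto)
    finally show ?thesis by (simp only: of_nat_mult power_mult_distrib mult.assoc)
  qed
  thus ?thesis unfolding power_bounded_def by blast
qed

text \<open>Take \<open>J\<close> so large that the remainder is holomorphic for real part above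
  \<open>\<sigma>\<close>. The finitely many main terms are translates of D(a, u) multiplied by
  polynomials in \<open>u\<close>.\<close>

lemma shifted_dseries_merom_ext:
  assumes "merom_dseries a" "power_bounded p a" "\<And>n. real n \<le> 2 * \<bar>t\<bar> \<Longrightarrow> a n = 0"
  shows "merom_ext \<sigma> (\<lambda>u. \<Sum>n. a n * of_real (real n + t) powr (-u))"
proof -
  define J where "J = nat \<lceil>real p + 1 - \<sigma>\<rceil>"
  have J: "real p + 1 - real J \<le> \<sigma>" unfolding J_def by linarith
  obtain R where R: "R holomorphic_on {u. Re u > real p + 1 - real J}"
    "\<forall>u. Re u > real p + 1 \<longrightarrow> (\<lambda>n. a n * of_real (real n + t) powr (-u)) sums
        ((\<Sum>j<J. ((-u) gchoose j) * of_real t ^ j * dseries a (u + of_nat j)) + R u)"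
    using shifted_dseries_expansion[where t = t and J = J, OF assms(2,3)] by blast
  have "merom_ext \<sigma> (\<lambda>u. (\<Sum>j<J. ((-u) gchoose j) * of_real t ^ j * dseries a (u + of_nat j)) + R u)"
  proof (intro merom_ext_add merom_ext_sum merom_ext_mult merom_ext_gbinomial merom_ext_const)
    have "merom_ext \<sigma> (dseries a)" using assms(1) unfolding merom_dseries_def by blast
    from merom_ext_translate[OF this, of "real j" \<sigma> for j]
    show "merom_ext \<sigma> (\<lambda>u. dseries a (u + of_nat j))" for j by simp
    have "R analytic_on {u. Re u > real p + 1 - real J}"
      using R(1) by (simp add: analytic_on_open open_halfspace_Re_gt)
    thus "merom_ext \<sigma> R"
      using J by (intro merom_ext_mono[OF merom_extI]) (auto intro: analytic_on_imp_meromorphic_on)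
  qed
  thus ?thesis
    by (rule merom_ext_cong[where \<rho> = "real p + 1"]) (use R(2) in \<open>auto simp: sums_iff\<close>)
qed

text \<open>Reindexing turns the sum of a(n + i) n^(-u) into the sum of a(n) (n - i)^(-u), a shifted
  series with t = -i.\<close>

lemma merom_dseries_shift:
  assumes "merom_dseries a" "power_bounded p a"
  shows "merom_dseries (\<lambda>n. a (n + i))"
proof -
  \<comment> \<open>With this bound \<open>b\<close> vanishes for n <= 2i = 2|t|, as the expansion
    demands.\<close>
  define N where "N = 2 * i + 1"
  define b where "b = (\<lambda>n. if n < N then 0 else a n)"
  have bd: "power_bounded p b"
    using assms(2) by (rule power_bounded_comparison) (auto simp: b_def)
  have mb: "merom_dseries b"
    using assms by (rule merom_dseries_cofinite[where N = N]) (auto simp: b_def)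
  have z: "b n = 0" if "real n \<le> 2 * \<bar>- real i\<bar>" for n
    using that unfolding b_def N_def by auto
  have "merom_dseries (\<lambda>n. b (n + i))"
    unfolding merom_dseries_def
  proof
    fix \<sigma>
    show "merom_ext \<sigma> (dseries (\<lambda>n. b (n + i)))"
    proof (rule merom_ext_cong[OF shifted_dseries_merom_ext[where t = "- real i", OF mb bd z]])
      fix u assume u: "Re u > real p + 1"
      have "(\<lambda>n. b n * of_real (real n + - real i) powr (-u)) sums
         (\<Sum>n. b n * of_real (real n + - real i) powr (-u))"
        by (rule shifted_dseries_expansion[where t = "- real i" and J = 0, OF bd z])
          (use u in \<open>auto simp: sums_iff\<close>)
      hence "(\<lambda>n. b (n + i) * of_real (real (n + i) + - real i) powr (-u)) sums
         (\<Sum>n. b n * of_real (real n + - real i) powr (-u))"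
        by (subst sums_iff_shift) (simp add: b_def N_def)
      thus "dseries (\<lambda>n. b (n + i)) u = (\<Sum>n. b n * of_real (real n + - real i) powr (-u))"
        by (simp add: dseries_def sums_iff)
    qed
  qed
  thus ?thesis
    by (rule merom_dseries_cofinite[OF _ power_bounded_shift[OF bd], of _ N]) (auto simp: b_def)
qed

lemma merom_dseries_divide_power:
  assumes "merom_dseries a"
  shows "merom_dseries (\<lambda>n. a n / of_nat n ^ w)"
  unfolding merom_dseries_def
proof
  fix \<sigma>
  have eq: "dseries (\<lambda>n. a n / of_nat n ^ w) u = dseries a (u + of_real (real w))" for u
    unfolding dseries_def
  proof (intro suminf_cong)
    fix n show "a n / of_nat n ^ w * of_nat n powr (-u) = a n * of_nat n powr (-(u + of_real (real w)))"
      by (cases "n = 0") (auto simp: powr_diff powr_nat')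
  qed
  have "merom_ext \<sigma> (dseries a)" using assms unfolding merom_dseries_def by blast
  hence "merom_ext \<sigma> (\<lambda>u. dseries a (u + of_real (real w)))"
    by (rule merom_ext_translate) simp
  thus "merom_ext \<sigma> (dseries (\<lambda>n. a n / of_nat n ^ w))"
    by (rule merom_ext_cong[where \<rho> = 0]) (rule eq)
qed

lemma merom_dseries_sum:
  assumes "\<And>i. i \<in> I \<Longrightarrow> merom_dseries (a i)" "\<And>i. i \<in> I \<Longrightarrow> power_bounded p (a i)"
  shows "merom_dseries (\<lambda>n. \<Sum>i\<in>I. a i n)"
  unfolding merom_dseries_def
proof
  fix \<sigma>
  have "merom_ext \<sigma> (\<lambda>u. \<Sum>i\<in>I. dseries (a i) u)"
    using assms(1) unfolding merom_dseries_def by (intro merom_ext_sum) blast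
  thus "merom_ext \<sigma> (dseries (\<lambda>n. \<Sum>i\<in>I. a i n))"
  proof (rule merom_ext_cong[where \<rho> = "real p + 1"])
    fix u assume u: "Re u > real p + 1"
    have "(\<lambda>n. \<Sum>i\<in>I. a i n * of_nat n powr (-u)) sums (\<Sum>i\<in>I. dseries (a i) u)"
      by (intro sums_sum dseries_sums[OF assms(2) u])
    thus "dseries (\<lambda>n. \<Sum>i\<in>I. a i n) u = (\<Sum>i\<in>I. dseries (a i) u)"
      by (simp add: dseries_def sum_distrib_right sums_iff)
  qed
qed

text \<open>As the first coefficients vanish, D(a, u) is the sum of a(n + q) (n + q)^(-u), that is,
  the sum of a(n) (n + q)^(-u) plus the series \<open>Y\<close> of the differences, which already
  continues. The bound 3q makes \<open>a\<close> and also the differences vanish up to 2q, so both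
  shifted series can be expanded.\<close>

lemma merom_dseries_of_difference_aux:
  assumes bda: "power_bounded p a" and q: "q > 0"
    and a0: "\<And>n. n \<le> 3 * q \<Longrightarrow> a n = 0"
    and diff: "merom_dseries (\<lambda>n. a (n + q) - a n)"
  shows "merom_dseries a"
proof -
  define b where "b = (\<lambda>n. a (n + q) - a n)"
  have bdb: "power_bounded p b"
  proof -
    have "power_bounded p (\<lambda>n. - a n)"
      using bda by (rule power_bounded_comparison) auto
    from power_bounded_add[OF power_bounded_shift[OF bda] this] show ?thesis
      by (simp add: b_def)
  qed
  have za: "a n = 0" and zb: "b n = 0" if "real n \<le> 2 * \<bar>real q\<bar>" for n
    using that a0 by (auto simp: b_def)
  define Y where "Y = (\<lambda>u. \<Sum>n. b n * of_real (real n + real q) powr (-u))"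
  have Y: "merom_ext \<sigma> Y" for \<sigma>
    unfolding Y_def
    by (rule shifted_dseries_merom_ext[where t = "real q", OF diff[folded b_def] bdb zb])
  have Y_sums: "(\<lambda>n. b n * of_real (real n + real q) powr (-u)) sums Y u"
    if "Re u > real p + 1" for u
    by (rule shifted_dseries_expansion[where t = "real q" and J = 0, OF bdb zb])
      (use that in \<open>auto simp: sums_iff Y_def\<close>)
  have "merom_ext (real p + 1 - real N) (dseries a)" for N
  proof (induction N)
    case 0
    obtain R where R: "R holomorphic_on {u. Re u > real p + 1 - real 0}"
      "\<forall>u. Re u > real p + 1 \<longrightarrow> (\<lambda>n. a n * of_real (real n + 0) powr (-u)) sums
          ((\<Sum>j<0. ((-u) gchoose j) * of_real 0 ^ j * dseries a (u + of_nat j)) + R u)"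
      by (rule shifted_dseries_expansion[where t = 0 and J = 0, OF bda]) (use a0 in auto)
    have "R analytic_on {u. Re u > real p + 1 - real 0}"
      using R(1) by (subst analytic_on_open) (auto simp: open_halfspace_Re_gt)
    hence "merom_ext (real p + 1 - real 0) R"
      by (intro merom_extI analytic_on_imp_meromorphic_on)
    thus ?case
      by (rule merom_ext_cong[where \<rho> = "real p + 1"])
        (use R(2) in \<open>auto simp: dseries_def sums_iff\<close>)
  next
    case (Suc N)
    define \<sigma> where "\<sigma> = real p + 1 - real N"
    \<comment> \<open>With \<open>N + 2\<close> terms the remainder is holomorphic for real part
      above \<open>\<sigma> - 2\<close>. There D(a, u + j) is known for j >= 2 by induction, so D(a,
      u + 1) is obtained on the same half-plane, a gain of one unit for D(a, u).\<close>
    obtain R where R: "R holomorphic_on {u. Re u > real p + 1 - real (N + 2)}"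
      "\<forall>u. Re u > real p + 1 \<longrightarrow> (\<lambda>n. a n * of_real (real n + real q) powr (-u)) sums
          ((\<Sum>j<N+2. ((-u) gchoose j) * of_real (real q) ^ j * dseries a (u + of_nat j)) + R u)"
      using shifted_dseries_expansion[where t = "real q" and J = "N + 2", OF bda za] by blast
    have "merom_ext (\<sigma> - 2) (\<lambda>u. ((\<Sum>j<N. ((-u) gchoose (j + 2)) * of_real (real q) ^ (j + 2) *
         dseries a (u + of_real (real (j + 2)))) + (R u + Y u)) * inverse (u * of_nat q))"
    proof (intro merom_ext_add merom_ext_sum merom_ext_mult merom_ext_gbinomial merom_ext_const Y)
      show "merom_ext (\<sigma> - 2) (\<lambda>u. dseries a (u + of_real (real (j + 2))))" for j
        by (rule merom_ext_translate[OF Suc.IH]) (simp add: \<sigma>_def)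
      have "R analytic_on {u. Re u > real p + 1 - real (N + 2)}"
        using R(1) by (subst analytic_on_open) (auto simp: open_halfspace_Re_gt)
      thus "merom_ext (\<sigma> - 2) R"
        unfolding \<sigma>_def by (intro merom_extI analytic_on_imp_meromorphic_on) (simp add: algebra_simps)
      show "merom_ext (\<sigma> - 2) (\<lambda>u. inverse (u * of_nat q))"
        by (intro merom_extI meromorphic_intros)
    qed
    hence "merom_ext (\<sigma> - 2) (\<lambda>u. dseries a (u + 1))"
    proof (rule merom_ext_cong[where \<rho> = "real p + 1"])
      fix u assume u: "Re u > real p + 1"
      let ?T = "\<lambda>j. ((-u) gchoose j) * of_real (real q) ^ j * dseries a (u + of_nat j)"
      have "(\<lambda>n. a n * of_real (real n + real q) powr (-u) + b n * of_real (real n + real q) powr (-u))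
         sums ((\<Sum>j<N+2. ?T j) + R u + Y u)"
        using R(2) u by (intro sums_add Y_sums) auto
      hence "(\<lambda>n. a (n + q) * of_nat (n + q) powr (-u)) sums ((\<Sum>j<N+2. ?T j) + R u + Y u)"
        by (simp add: b_def algebra_simps)
      moreover have "(\<lambda>n. a (n + q) * of_nat (n + q) powr (-u)) sums dseries a u"
        by (subst sums_iff_shift) (use dseries_sums[OF bda u] a0 in auto)
      ultimately have "dseries a u = (\<Sum>j<N+2. ?T j) + R u + Y u"
        using sums_unique2 by blast
      \<comment> \<open>The term for j = 0 is D(a, u) and cancels against the left-hand side. The
        term for j = 1 is -u q D(a, u + 1); solving for it divides by \<open>u * q\<close>, which
        may create a pole.\<close>
      also have "(\<Sum>j<N+2. ?T j) = dseries a u - u * of_nat q * dseries a (u + 1)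
          + (\<Sum>j<N. ?T (j + 2))"
        by (simp add: sum.lessThan_Suc_shift del: sum.lessThan_Suc)
      finally have "u * of_nat q * dseries a (u + 1) = (\<Sum>j<N. ?T (j + 2)) + (R u + Y u)"
        by (simp add: algebra_simps)
      moreover have "u * of_nat q \<noteq> 0" using u q by auto
      ultimately show "dseries a (u + 1) = ((\<Sum>j<N. ((-u) gchoose (j + 2)) * of_real (real q) ^ (j + 2) *
         dseries a (u + of_real (real (j + 2)))) + (R u + Y u)) * inverse (u * of_nat q)"
        by (simp add: field_simps)
    qed
    from merom_ext_translate[OF this, of "-1" "\<sigma> - 1"] show ?case
      by (simp add: \<sigma>_def algebra_simps)
  qed
  moreover have "real p + 1 - real (nat \<lceil>real p + 1 - \<sigma>\<rceil>) \<le> \<sigma>" for \<sigma> by linarith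
  ultimately show ?thesis unfolding merom_dseries_def using merom_ext_mono by blast
qed

text \<open>Clearing the coefficients up to 3q alters both the sequence and its differences at
  finitely many places only.\<close>

lemma merom_dseries_of_difference:
  assumes "power_bounded p a" "q > 0" "merom_dseries (\<lambda>n. a (n + q) - a n)"
  shows "merom_dseries a"
proof -
  define a' where "a' = (\<lambda>n. if n \<le> 3 * q then 0 else a n)"
  have bd: "power_bounded p a'"
    using assms(1) by (rule power_bounded_comparison) (auto simp: a'_def)
  have bdd: "power_bounded p (\<lambda>n. a (n + q) - a n)"
  proof -
    have "power_bounded p (\<lambda>n. - a n)"
      using assms(1) by (rule power_bounded_comparison) auto
    from power_bounded_add[OF power_bounded_shift[OF assms(1)] this] show ?thesis by simp
  qed
  have "merom_dseries (\<lambda>n. a' (n + q) - a' n)"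
    by (rule merom_dseries_cofinite[OF assms(3) bdd, of "3 * q + 1"]) (auto simp: a'_def)
  hence "merom_dseries a'"
    by (intro merom_dseries_of_difference_aux[OF bd assms(2)]) (auto simp: a'_def)
  thus ?thesis
    by (rule merom_dseries_cofinite[OF _ bd, of "3 * q + 1"]) (auto simp: a'_def)
qed

text \<open>The multiple harmonic sum over n > m_1 > ... > m_r >= 1. Because the upper bound is
  strict, \<open>chi n * mhs w n\<close> is the coefficient of n^(-u) in the multiple L-series whose
  tail of exponents is \<open>w\<close>.\<close>

fun mhs :: "nat list \<Rightarrow> nat \<Rightarrow> complex" where
  "mhs [] n = 1"
| "mhs (w # ws) n = (\<Sum>m=1..<n. mhs ws m / of_nat m ^ w)"

lemma norm_mhs_le: "norm (mhs ws n) \<le> real n ^ length ws"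
proof (induction ws arbitrary: n)
  case (Cons w ws)
  have "norm (mhs (w # ws) n) \<le> (\<Sum>m=1..<n. real n ^ length ws)"
    unfolding mhs.simps
  proof (rule sum_norm_le)
    fix m assume m: "m \<in> {1..<n}"
    have "norm (mhs ws m / of_nat m ^ w) \<le> real m ^ length ws / 1"
      unfolding norm_divide by (rule frac_le) (use Cons m in \<open>auto simp: norm_power\<close>)
    also have "\<dots> \<le> real n ^ length ws" using m by (auto intro: power_mono)
    finally show "norm (mhs ws m / of_nat m ^ w) \<le> real n ^ length ws" .
  qed
  also have "\<dots> \<le> real n * real n ^ length ws" by (simp add: mult_right_mono)
  finally show ?case by simp
qed auto

section \<open>Periodic functions times multiple harmonic sums\<close>

lemma periodic_mult:
  fixes chi :: "nat \<Rightarrow> 'a"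
  assumes "\<And>n. chi (n + q) = chi n"
  shows "chi (n + i * q) = chi n"
proof (induction i)
  case (Suc i)
  thus ?case using assms[of "n + i * q"] by (simp add: algebra_simps)
qed auto

lemma periodic_bounded:
  fixes chi :: "nat \<Rightarrow> complex"
  assumes "\<And>n. chi (n + q) = chi n" "q > 0"
  obtains C where "C \<ge> 0" "\<And>n. norm (chi n) \<le> C"
proof
  show "(\<Sum>i<q. norm (chi i)) \<ge> 0" by (intro sum_nonneg) auto
  fix n
  have "chi n = chi (n mod q)"
    using periodic_mult[of chi q "n mod q" "n div q"] assms(1) by simp
  thus "norm (chi n) \<le> (\<Sum>i<q. norm (chi i))"
    using member_le_sum[of "n mod q" "{..<q}" "\<lambda>i. norm (chi i)"] assms(2) by auto
qed

lemma power_bounded_periodic_mhs: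
  fixes chi :: "nat \<Rightarrow> complex"
  assumes "\<And>n. chi (n + q) = chi n" "q > 0"
  shows "power_bounded (length ws) (\<lambda>n. chi n * mhs ws n)"
proof -
  obtain C where "C \<ge> 0" "\<And>n. norm (chi n) \<le> C"
    using periodic_bounded[of chi, OF assms] by blast
  hence "norm (chi n * mhs ws n) \<le> C * real n ^ length ws" for n
    unfolding norm_mult by (intro mult_mono norm_mhs_le) auto
  thus ?thesis unfolding power_bounded_def by blast
qed

text \<open>Induction on the depth: the difference over a period is \<open>chi n\<close> times a
  block of \<open>q\<close> summands of smaller depth, and in depth 0 it is zero. Periodicity alone
  is assumed because the induction hypothesis is applied to translates of \<open>chi\<close>, which
  need not be multiplicative.\<close>

lemma merom_dseries_periodic_mhs:
  assumes "\<And>n. chi (n + q) = chi n" "q > 0"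
  shows "merom_dseries (\<lambda>n. chi n * mhs ws n)"
  using assms(1)
proof (induction ws arbitrary: chi)
  case Nil
  have "merom_dseries (\<lambda>n. chi (n + q) * mhs [] (n + q) - chi n * mhs [] n)"
    by (simp add: merom_dseries_def Nil dseries_def[abs_def] merom_ext_const)
  thus ?case
    by (rule merom_dseries_of_difference[OF power_bounded_periodic_mhs[of chi, OF Nil assms(2)] assms(2)])
next
  case (Cons w ws)
  \<comment> \<open>Since (q - 1) i is congruent to -i modulo \<open>q\<close>, this encodes chi(m -
    i) without subtraction. At m = n + i the factor becomes \<open>chi n\<close>, so the summands of
    the block are shifts of functions covered by the induction hypothesis.\<close>
  define c where "c = (\<lambda>i m. chi (m + (q - 1) * i) * mhs ws m)"
  have per: "chi (m + q + (q - 1) * i) = chi (m + (q - 1) * i)" for m i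
    using Cons.prems[of "m + (q - 1) * i"] by (simp add: algebra_simps)
  have c: "merom_dseries (c i)" "power_bounded (length ws) (c i)" for i
    unfolding c_def using per assms(2)
    by (intro Cons.IH power_bounded_periodic_mhs[of _ q]; simp)+
  define d where "d = (\<lambda>i n. c i (n + i) / of_nat (n + i) ^ w)"
  have cw: "power_bounded (length ws) (\<lambda>n. c i n / of_nat n ^ w)" for i
  proof (rule power_bounded_comparison[OF c(2)])
    fix n :: nat assume "n \<ge> 1"
    hence "norm (c i n / of_nat n ^ w) \<le> norm (c i n) / 1"
      unfolding norm_divide by (intro frac_le) (auto simp: norm_power)
    thus "norm (c i n / of_nat n ^ w) \<le> norm (c i n)" by simp
  qed
  have d: "merom_dseries (d i)" "power_bounded (length ws) (d i)" for i
    unfolding d_def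
    using merom_dseries_shift[OF merom_dseries_divide_power[OF c(1)] cw]
      power_bounded_shift[OF cw] by blast+
  have "merom_dseries (\<lambda>n. \<Sum>i<q. d i n)" "power_bounded (length ws) (\<lambda>n. \<Sum>i<q. d i n)"
    using d by (auto intro!: merom_dseries_sum power_bounded_sum)
  hence "merom_dseries (\<lambda>n. chi (n + q) * mhs (w # ws) (n + q) - chi n * mhs (w # ws) n)"
  \<comment> \<open>At n = 0 the block would contain m = 0, which \<open>mhs\<close> omits; the
    identity is therefore claimed from 1 on.\<close>
  proof (rule merom_dseries_cofinite[where N = 1])
    fix n :: nat assume n: "n \<ge> 1"
    have "{1..<n+q} = {1..<n} \<union> {n..<n+q}" "{1..<n} \<inter> {n..<n+q} = {}" using n by auto
    hence "mhs (w # ws) (n + q) - mhs (w # ws) n = (\<Sum>m=n..<n+q. mhs ws m / of_nat m ^ w)"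
      by (simp add: sum.union_disjoint)
    also have "\<dots> = (\<Sum>i<q. mhs ws (n + i) / of_nat (n + i) ^ w)"
      by (rule sum.reindex_bij_witness[of _ "\<lambda>i. n + i" "\<lambda>m. m - n"]) auto
    finally have "chi (n + q) * mhs (w # ws) (n + q) - chi n * mhs (w # ws) n =
        chi n * (\<Sum>i<q. mhs ws (n + i) / of_nat (n + i) ^ w)"
      using Cons.prems[of n] by (simp only: right_diff_distrib[symmetric])
    also have "\<dots> = (\<Sum>i<q. d i n)"
    proof -
      have "chi (n + i + (q - 1) * i) = chi n" for i
        using periodic_mult[of chi q n i] Cons.prems assms(2)
        by (cases q) (auto simp: algebra_simps)
      thus ?thesis by (simp add: d_def c_def sum_distrib_left)
    qed
    finally show "chi (n + q) * mhs (w # ws) (n + q) - chi n * mhs (w # ws) n = (\<Sum>i<q. d i n)" .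
  qed
  thus ?case
    by (rule merom_dseries_of_difference[OF
          power_bounded_periodic_mhs[of chi, OF Cons.prems assms(2)] assms(2)])
qed

subsection \<open>Continuation to the whole plane\<close>

lemma nicely_meromorphic_remove_sings:
  assumes "f nicely_meromorphic_on A" "z \<in> A"
  shows "remove_sings f z = f z"
proof -
  from assms have "(is_pole f z \<and> f z = 0) \<or> f \<midarrow>z\<rightarrow> f z"
    unfolding nicely_meromorphic_on_def by blast
  thus ?thesis by (auto intro: remove_sings_eqI)
qed

text \<open>The identity theorem gives equality on a punctured neighbourhood of \<open>z\<close>. It
  extends to \<open>z\<close> itself because a nicely meromorphic function equals its own
  \<open>remove_sings\<close>, which depends only on the punctured neighbourhood.\<close>

lemma nicely_meromorphic_eqI:
  assumes f: "f nicely_meromorphic_on A" and g: "g nicely_meromorphic_on A"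
    and A: "open A" "connected A" and B: "open B" "B \<noteq> {}" "B \<subseteq> A"
    and eq: "\<And>z. z \<in> B \<Longrightarrow> f z = g z" and z: "z \<in> A"
  shows "f z = g z"
proof -
  define d where "d = (\<lambda>z. f z - g z)"
  have mer: "f meromorphic_on A" "g meromorphic_on A"
    using f g unfolding nicely_meromorphic_on_def by blast+
  hence d: "d meromorphic_on A" unfolding d_def by (intro meromorphic_intros)
  obtain b where b: "b \<in> B" using B by blast
  have "eventually (\<lambda>u. u \<in> B) (at b)" using B b by (intro eventually_at_in_open')
  hence ev: "eventually (\<lambda>u. remove_sings d u = 0) (at b)"
  proof eventually_elim
    case (elim u)
    have "eventually (\<lambda>v. v \<in> B) (at u)" using B elim by (intro eventually_at_in_open')
    hence "eventually (\<lambda>v. d v = 0) (at u)" by eventually_elim (use eq in \<open>auto simp: d_def\<close>)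
    thus ?case by (intro remove_sings_eqI tendsto_eventually)
  qed
  have zero: "remove_sings d u = 0" if "u \<in> A" for u
    by (rule frequently_eq_meromorphic_imp_constant[of "remove_sings d" 0 b A])
      (use ev b B A that d in \<open>auto intro: eventually_frequently remove_sings_nicely_meromorphic\<close>)
  have "eventually (\<lambda>u. u \<in> A) (at z)" using A z by (intro eventually_at_in_open')
  moreover have "eventually (\<lambda>u. remove_sings d u = d u) (at z)"
    using d z meromorphic_on_isolated_singularity meromorphic_on_subset
    by (intro eventually_remove_sings_eq_at) blast
  ultimately have "eventually (\<lambda>u. f u = g u) (at z)"
    by eventually_elim (use zero in \<open>auto simp: d_def\<close>)
  hence "remove_sings f z = remove_sings g z" by (rule remove_sings_cong) simp
  thus ?thesis
    using nicely_meromorphic_remove_sings[OF f z] nicely_meromorphic_remove_sings[OF g z] by simp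
qed

lemma nicely_meromorphic_cong_open:
  assumes "g nicely_meromorphic_on A" "open A" "\<And>z. z \<in> A \<Longrightarrow> f z = g z"
  shows "f nicely_meromorphic_on A"
proof -
  have ev: "eventually (\<lambda>u. f u = g u) (at z)" if "z \<in> A" for z
  proof -
    have "eventually (\<lambda>u. u \<in> A) (at z)" using assms that by (intro eventually_at_in_open')
    thus ?thesis by eventually_elim (use assms in auto)
  qed
  have "f meromorphic_on A"
    using meromorphic_on_cong[OF ev refl] assms(1) by (auto simp: nicely_meromorphic_on_def)
  moreover have "(is_pole f z \<and> f z = 0) \<or> f \<midarrow>z\<rightarrow> f z" if z: "z \<in> A" for z
  proof -
    have "is_pole f z \<longleftrightarrow> is_pole g z" by (rule is_pole_cong[OF ev[OF z] refl])
    moreover have "(f \<midarrow>z\<rightarrow> f z) \<longleftrightarrow> (g \<midarrow>z\<rightarrow> f z)" by (rule tendsto_cong[OF ev[OF z]])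
    ultimately show ?thesis
      using assms(1,3) z unfolding nicely_meromorphic_on_def by auto
  qed
  ultimately show ?thesis unfolding nicely_meromorphic_on_def by blast
qed

text \<open>Two continuations agree on the smaller of their two half-planes, hence everywhere, so
  the definite description can be evaluated by exhibiting one candidate.\<close>

lemma mero_continuation_eqI:
  assumes "g nicely_meromorphic_on UNIV" "\<And>u. Re u > \<sigma> \<Longrightarrow> g u = f u"
  shows "mero_continuation f = g"
  unfolding mero_continuation_def
proof (rule the_equality)
  show "g nicely_meromorphic_on UNIV \<and> (\<exists>\<sigma>. \<forall>u. \<sigma> < Re u \<longrightarrow> g u = f u)" using assms by blast
next
  fix h assume "h nicely_meromorphic_on UNIV \<and> (\<exists>\<sigma>. \<forall>u. \<sigma> < Re u \<longrightarrow> h u = f u)"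
  then obtain \<tau> where h: "h nicely_meromorphic_on UNIV" "\<And>u. \<tau> < Re u \<Longrightarrow> h u = f u" by blast
  show "h = g"
  proof
    fix z
    define r where "r = max \<sigma> \<tau>"
    show "h z = g z"
    proof (rule nicely_meromorphic_eqI[OF h(1) assms(1) open_UNIV connected_UNIV])
      show "open {u. Re u > r}" by (rule open_halfspace_Re_gt)
      have "of_real (r + 1) \<in> {u. Re u > r}" by simp
      thus "{u. Re u > r} \<noteq> {}" by blast
    qed (use h assms in \<open>auto simp: r_def\<close>)
  qed
qed

lemma remove_sings_eq_holomorphic:
  assumes g: "\<And>u. Re u > r \<Longrightarrow> g u = f u" and hol: "f holomorphic_on {u. Re u > \<rho>}"
  assumes u: "Re u > max r \<rho>"
  shows "remove_sings g u = f u"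
proof (rule remove_sings_eqI)
  have "eventually (\<lambda>v. v \<in> {u. Re u > r}) (at u)"
    using u open_halfspace_Re_gt by (intro eventually_at_in_open') auto
  hence ev: "eventually (\<lambda>v. g v = f v) (at u)" by eventually_elim (use g in auto)
  have "isCont f u"
    using holomorphic_on_imp_continuous_on[OF hol] u
    by (auto simp: continuous_on_eq_continuous_at open_halfspace_Re_gt)
  hence "f \<midarrow>u\<rightarrow> f u" by (rule isContD)
  thus "g \<midarrow>u\<rightarrow> f u" using tendsto_cong[OF ev] by blast
qed

text \<open>The extensions to Re u > -n are normalised by \<open>remove_sings\<close> and then agree
  on overlaps by the identity theorem. Holomorphy of \<open>f\<close> on the right ensures that the
  normalisation keeps the agreement with \<open>f\<close>.\<close>

lemma merom_ext_glue:
  assumes ext: "\<And>\<sigma>. merom_ext \<sigma> f" and hol: "f holomorphic_on {u. Re u > \<rho>}"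
  obtains g \<tau> where "g nicely_meromorphic_on UNIV" "\<And>u. Re u > \<tau> \<Longrightarrow> g u = f u"
proof -
  define H where "H = (\<lambda>n::nat. {u. Re u > - real n})"
  have H: "open (H n)" "connected (H n)" for n
    unfolding H_def by (auto simp: open_halfspace_Re_gt intro!: convex_connected convex_halfspace_Re_gt)
  have "\<exists>h r. h nicely_meromorphic_on H n \<and> (\<forall>u. Re u > r \<longrightarrow> h u = f u)" for n
  proof -
    obtain g r where g: "g meromorphic_on H n" "\<And>u. Re u > r \<Longrightarrow> g u = f u"
      using ext[of "- real n"] unfolding merom_ext_def H_def by blast
    show ?thesis
      using remove_sings_nicely_meromorphic[OF g(1)] remove_sings_eq_holomorphic[OF g(2) hol] by blast
  qed
  then obtain h r where h: "\<And>n. h n nicely_meromorphic_on H n"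
    and hr: "\<And>n u. Re u > r n \<Longrightarrow> h n u = f u" by metis
  have agree_le: "h m u = h n u" if "m \<le> n" "u \<in> H m" for m n u
  proof (rule nicely_meromorphic_eqI[OF h _ H(1,2)])
    have sub: "H m \<subseteq> H n" using that by (auto simp: H_def)
    show "h n nicely_meromorphic_on H m" using h sub nicely_meromorphic_on_subset by blast
    define t where "t = max 0 (max (r m) (r n))"
    show "open {u. Re u > t}" by (rule open_halfspace_Re_gt)
    show "{u. Re u > t} \<subseteq> H m" by (auto simp: H_def t_def)
    have "of_real (t + 1) \<in> {u. Re u > t}" by simp
    thus "{u. Re u > t} \<noteq> {}" by blast
    show "h m z = h n z" if "z \<in> {u. Re u > t}" for z
      using that hr by (auto simp: t_def)
    show "u \<in> H m" by fact
  qed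
  have agree: "h m u = h n u" if "u \<in> H m" "u \<in> H n" for m n u
    using agree_le[OF _ that(1)] agree_le[OF _ that(2)] by (metis nat_le_linear)
  \<comment> \<open>The index of a half-plane containing \<open>u\<close>; the successor makes the
    inequality strict.\<close>
  define N where "N = (\<lambda>u. Suc (nat \<lceil>- Re u\<rceil>))"
  have N: "u \<in> H (N u)" for u unfolding H_def N_def by simp linarith
  define g where "g = (\<lambda>u. h (N u) u)"
  have g_eq: "g u = h n u" if "u \<in> H n" for u n
    unfolding g_def by (rule agree[OF N that])
  have "g nicely_meromorphic_on H n" for n
    by (rule nicely_meromorphic_cong_open[OF h H(1) g_eq])
  hence "g nicely_meromorphic_on UNIV"
    using N unfolding nicely_meromorphic_on_def meromorphic_on_def by blast
  moreover have "g u = f u" if "Re u > max 0 (r 0)" for u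
    using g_eq[of u 0] hr[of 0 u] that by (auto simp: H_def)
  ultimately show ?thesis using that by blast
qed

text \<open>The remainder for \<open>t = 0\<close> and \<open>J = 0\<close> is the series itself.
  The coefficient at 0 is cleared first, since the expansion requires it to vanish.\<close>

lemma dseries_holomorphic:
  assumes "power_bounded p a"
  shows "dseries a holomorphic_on {u. Re u > real p + 1}"
proof -
  define b where "b = a(0 := 0)"
  have bd: "power_bounded p b"
    using assms by (rule power_bounded_comparison) (auto simp: b_def)
  obtain R where R: "R holomorphic_on {u. Re u > real p + 1 - real 0}"
      "\<forall>u. Re u > real p + 1 \<longrightarrow> (\<lambda>n. b n * of_real (real n + 0) powr (-u)) sums
          ((\<Sum>j<0. ((-u) gchoose j) * of_real 0 ^ j * dseries b (u + of_nat j)) + R u)"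
    by (rule shifted_dseries_expansion[where t = 0 and J = 0, OF bd]) (auto simp: b_def)
  have "dseries a u = dseries b u" for u
    unfolding dseries_def by (intro suminf_cong) (simp add: b_def)
  hence "dseries a u = R u" if "Re u > real p + 1" for u
    using R(2) that by (auto simp: dseries_def sums_iff)
  thus ?thesis using R(1) by (subst holomorphic_cong[OF refl, of _ _ R]) auto
qed

text \<open>Guarantees that the definite description in \<open>mero_continuation\<close> denotes an
  actual continuation.\<close>

lemma mero_continuation_dseries:
  assumes "merom_dseries a" "power_bounded p a" "\<And>u. Re u > \<rho> \<Longrightarrow> F u = dseries a u"
  shows "mero_continuation F nicely_meromorphic_on UNIV"
    "\<exists>\<sigma>. \<forall>u. Re u > \<sigma> \<longrightarrow> mero_continuation F u = F u"
proof -
  obtain g \<tau> where g: "g nicely_meromorphic_on UNIV" "\<And>u. Re u > \<tau> \<Longrightarrow> g u = dseries a u"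
    using merom_ext_glue[OF _ dseries_holomorphic[OF assms(2)]] assms(1)
    unfolding merom_dseries_def by metis
  hence eq: "g u = F u" if "Re u > max \<tau> \<rho>" for u using assms(3) that by auto
  have "mero_continuation F = g" by (rule mero_continuation_eqI[OF g(1) eq])
  thus "mero_continuation F nicely_meromorphic_on UNIV"
    "\<exists>\<sigma>. \<forall>u. Re u > \<sigma> \<longrightarrow> mero_continuation F u = F u"
    using g eq by blast+
qed

subsection \<open>Partial fractions for Mordell--Tornheim sums\<close>

text \<open>The polylogarithm as a formal power series. The explicit case \<open>m = 0\<close>
  matters for exponent 0, where \<open>0 ^ 0 = 1\<close> would add a constant term to X/(1 -
  X).\<close>

definition Li_fps :: "nat \<Rightarrow> complex fps" where
  "Li_fps a = Abs_fps (\<lambda>m. if m = 0 then 0 else 1 / of_nat m ^ a)"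

lemma XD_Li_fps: "a \<ge> 1 \<Longrightarrow> fps_XD (Li_fps a) = Li_fps (a - 1)"
  by (cases a) (auto simp: fps_eq_iff Li_fps_def)

lemma fps_XD_mult: "fps_XD (a * b) = fps_XD a * b + a * fps_XD (b :: 'a :: comm_ring_1 fps)"
  by (simp add: fps_XD_def algebra_simps)

lemma fps_XD_prod:
  fixes f :: "'b \<Rightarrow> 'a :: comm_ring_1 fps"
  assumes "finite I"
  shows "fps_XD (\<Prod>i\<in>I. f i) = (\<Sum>i\<in>I. fps_XD (f i) * (\<Prod>j\<in>I - {i}. f j))"
  using assms
proof (induction I rule: finite_induct)
  case (insert x F)
  have "insert x F - {i} = insert x (F - {i})" if "i \<in> F" for i using that insert by auto
  hence "(\<Prod>j\<in>insert x F - {i}. f j) = f x * (\<Prod>j\<in>F - {i}. f j)" if "i \<in> F" for i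
    using that insert by simp
  moreover have "insert x F - {x} = F" using insert by auto
  ultimately show ?case
    using insert by (simp add: fps_XD_mult sum_distrib_left mult_ac)
qed (simp add: fps_XD_def)

text \<open>The missing constant terms of the two factors remove m = N and m = 0, which leaves
  exactly the strict range of \<open>mhs\<close>.\<close>

lemma Li_fps_0_mult_nth:
  assumes "fps_nth F 0 = 0"
  shows "fps_nth (Li_fps 0 * F) N = (\<Sum>m=1..<N. fps_nth F m)"
proof -
  have "fps_nth (Li_fps 0 * F) N = (\<Sum>m=0..N. fps_nth F m * fps_nth (Li_fps 0) (N - m))"
    by (subst mult.commute) (simp add: fps_mult_nth)
  also have "\<dots> = (\<Sum>m=1..<N. fps_nth F m)"
    by (rule sum.mono_neutral_cong_right) (use assms in \<open>auto simp: Li_fps_def Suc_le_eq not_less\<close>)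
  finally show ?thesis .
qed

lemma prod_Li_fps_nth_0:
  assumes "finite I" "I \<noteq> {}"
  shows "fps_nth (\<Prod>i\<in>I. Li_fps (s i)) 0 = 0"
  using assms by (induction I rule: finite_ne_induct) (auto simp: Li_fps_def)

text \<open>Tails of exponents for which a positive exponent n - sum is left over for the leading
  variable; the natural-number subtraction is then never truncated.\<close>

definition weight_lists :: "nat \<Rightarrow> nat \<Rightarrow> nat list set" where
  "weight_lists k n = {w. length w = k \<and> (\<forall>x\<in>set w. x \<ge> 1) \<and> sum_list w < n}"

lemma finite_weight_lists: "finite (weight_lists k n)"
proof (rule finite_subset)
  show "weight_lists k n \<subseteq> {w. set w \<subseteq> {..n} \<and> length w = k}"
    unfolding weight_lists_def using member_le_sum_list by fastforce
qed (simp add: finite_lists_length_eq)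

text \<open>Padding with zero coefficients brings combinations over different index sets to a common
  one, so that they can be added.\<close>

lemma sum_of_rat_restrict:
  assumes "finite B" "A \<subseteq> B"
  shows "(\<Sum>w\<in>A. of_rat (c w) * (f w :: complex)) = (\<Sum>w\<in>B. of_rat (if w \<in> A then c w else 0) * f w)"
  by (rule sum.mono_neutral_cong_left) (use assms in auto)

text \<open>Induction on the total weight. By the Leibniz rule, N times the coefficient is a sum
  over \<open>i\<close> of coefficients in which s_i is lowered by 1. If s_i >= 2, the same number
  of factors remains with smaller weight. If s_i = 1, the factor becomes Li_0 and summing the
  smaller product over m < N adds one entry to the harmonic sums. Dividing by N restores the
  weight.\<close>

lemma prod_Li_fps_mhs:
  assumes "finite I" "I \<noteq> {}" "\<And>i. i \<in> I \<Longrightarrow> s i \<ge> 1"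
  shows "\<exists>c. \<forall>N\<ge>1. fps_nth (\<Prod>i\<in>I. Li_fps (s i)) N =
     (\<Sum>w\<in>weight_lists (card I - 1) (sum s I). of_rat (c w) * (mhs w N / of_nat N ^ (sum s I - sum_list w)))"
  using assms
proof (induction "sum s I" arbitrary: I s rule: less_induct)
  case (less I s)
  define n where "n = sum s I"
  define k where "k = card I - 1"
  have n1: "n \<ge> card I"
    unfolding n_def using sum_mono[of I "\<lambda>_. 1" s] less.prems by simp
  have cI: "card I \<ge> 1" using less.prems by (simp add: Suc_le_eq card_gt_0_iff)
  show ?case
  proof (cases "card I = 1")
    case True
    then obtain i where I: "I = {i}" by (auto simp: card_1_singleton_iff)
    have "weight_lists 0 (s i) = {[]}" using less.prems(3)[of i] I by (auto simp: weight_lists_def)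
    thus ?thesis by (intro exI[of _ "\<lambda>_. 1"]) (auto simp: I Li_fps_def)
  next
    case False
    hence k1: "k \<ge> 1" using cI unfolding k_def by linarith
    define T where "T = (\<lambda>i. fps_XD (Li_fps (s i)) * (\<Prod>j\<in>I - {i}. Li_fps (s j)))"
    \<comment> \<open>All terms of the Leibniz rule are brought to one index set with total weight n
      - 1; the exponent of \<open>N\<close> may be 0 here and becomes positive after the division by
      \<open>N\<close>.\<close>
    have "\<exists>c. \<forall>N\<ge>1. fps_nth (T i) N =
       (\<Sum>w\<in>weight_lists k n. of_rat (c w) * (mhs w N / of_nat N ^ (n - 1 - sum_list w)))"
      if i: "i \<in> I" for i
    proof -
      have T: "T i = Li_fps (s i - 1) * (\<Prod>j\<in>I - {i}. Li_fps (s j))"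
        unfolding T_def using less.prems i by (simp add: XD_Li_fps)
      have n_eq: "n = s i + sum s (I - {i})"
        unfolding n_def using less.prems i by (intro sum.remove) auto
      show ?thesis
      proof (cases "s i = 1")
        case True
        have card: "card (I - {i}) - 1 = k - 1" using less.prems i by (simp add: k_def)
        have fin: "finite (I - {i})" using less.prems by simp
        have ne: "I - {i} \<noteq> {}"
        proof
          assume "I - {i} = {}"
          hence "I = {i}" using i by auto
          thus False using False by simp
        qed
        have sm: "sum s (I - {i}) = n - 1" using n_eq True by simp
        have "sum s (I - {i}) < sum s I" using n_eq True unfolding n_def by simp
        from less.hyps[OF this fin ne] less.prems(3)
        obtain c where "\<forall>N\<ge>1. fps_nth (\<Prod>j\<in>I - {i}. Li_fps (s j)) N =
            (\<Sum>w\<in>weight_lists (k - 1) (n - 1). of_rat (c w) * (mhs w N / of_nat N ^ (n - 1 - sum_list w)))"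
          unfolding card sm by blast
        hence c: "fps_nth (\<Prod>j\<in>I - {i}. Li_fps (s j)) N =
            (\<Sum>w\<in>weight_lists (k - 1) (n - 1). of_rat (c w) * (mhs w N / of_nat N ^ (n - 1 - sum_list w)))"
          if "N \<ge> 1" for N using that by blast
        \<comment> \<open>Summing mhs(w, m) / m^e over m < N gives \<open>mhs (e # w) N\<close>,
          with e = n - 1 - sum of \<open>w\<close>. The new list has sum n - 1, so no power of
          \<open>N\<close> is left over, and \<open>tl\<close> recovers \<open>w\<close> from
          it.\<close>
        define g where "g = (\<lambda>w. (n - 1 - sum_list w) # w)"
        define A where "A = g ` weight_lists (k - 1) (n - 1)"
        have A: "A \<subseteq> weight_lists k n"
          using k1 unfolding A_def g_def weight_lists_def by auto
        have "fps_nth (T i) N = (\<Sum>w\<in>weight_lists k n.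
            of_rat (if w \<in> A then c (tl w) else 0) * (mhs w N / of_nat N ^ (n - 1 - sum_list w)))"
          if N: "N \<ge> 1" for N
        proof -
          have "fps_nth (T i) N = (\<Sum>m=1..<N. fps_nth (\<Prod>j\<in>I - {i}. Li_fps (s j)) m)"
            unfolding T using True by (simp add: Li_fps_0_mult_nth prod_Li_fps_nth_0[OF fin ne])
          also have "\<dots> = (\<Sum>m=1..<N. \<Sum>w\<in>weight_lists (k - 1) (n - 1).
              of_rat (c w) * (mhs w m / of_nat m ^ (n - 1 - sum_list w)))"
            by (intro sum.cong refl c) auto
          also have "\<dots> = (\<Sum>w\<in>weight_lists (k - 1) (n - 1). of_rat (c w) * mhs (g w) N)"
            by (subst sum.swap) (simp add: g_def sum_distrib_left)
          also have "\<dots> = (\<Sum>w\<in>weight_lists (k - 1) (n - 1). of_rat (c (tl (g w))) *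
               (mhs (g w) N / of_nat N ^ (n - 1 - sum_list (g w))))"
            by (intro sum.cong) (auto simp: g_def weight_lists_def simp del: mhs.simps)
          also have "\<dots> = (\<Sum>w\<in>A. of_rat (c (tl w)) * (mhs w N / of_nat N ^ (n - 1 - sum_list w)))"
            unfolding A_def by (subst sum.reindex) (auto simp: g_def inj_on_def)
          also have "\<dots> = (\<Sum>w\<in>weight_lists k n.
            of_rat (if w \<in> A then c (tl w) else 0) * (mhs w N / of_nat N ^ (n - 1 - sum_list w)))"
            by (rule sum_of_rat_restrict[OF finite_weight_lists A])
          finally show ?thesis .
        qed
        note T_eq = this
        show ?thesis
          by (intro exI[of _ "\<lambda>w. if w \<in> A then c (tl w) else 0"] allI impI) (rule T_eq)
      next
        case False
        with less.prems(3)[OF i] have si: "s i \<ge> 2" by simp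
        define s' where "s' = s(i := s i - 1)"
        have sm: "sum s' I = n - 1"
        proof -
          have "sum s' I = s' i + sum s' (I - {i})"
            using less.prems i by (intro sum.remove) auto
          also have "sum s' (I - {i}) = sum s (I - {i})"
            by (intro sum.cong) (auto simp: s'_def)
          finally show ?thesis using n_eq si by (simp add: s'_def)
        qed
        have T': "T i = (\<Prod>j\<in>I. Li_fps (s' j))"
        proof -
          have "(\<Prod>j\<in>I. Li_fps (s' j)) = Li_fps (s' i) * (\<Prod>j\<in>I - {i}. Li_fps (s' j))"
            using less.prems i by (intro prod.remove) auto
          also have "(\<Prod>j\<in>I - {i}. Li_fps (s' j)) = (\<Prod>j\<in>I - {i}. Li_fps (s j))"
            by (intro prod.cong) (auto simp: s'_def)
          finally show ?thesis by (simp add: T s'_def)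
        qed
        have lt: "sum s' I < sum s I" using sm n1 cI unfolding n_def by linarith
        have "s' j \<ge> 1" if "j \<in> I" for j using less.prems(3)[OF that] si by (auto simp: s'_def)
        note pos = this
        have A: "weight_lists k (n - 1) \<subseteq> weight_lists k n" by (auto simp: weight_lists_def)
        from less.hyps[OF lt less.prems(1,2) pos]
        obtain c where "\<forall>N\<ge>1. fps_nth (T i) N =
            (\<Sum>w\<in>weight_lists k (n - 1). of_rat (c w) * (mhs w N / of_nat N ^ (n - 1 - sum_list w)))"
          unfolding sm T' k_def by blast
        thus ?thesis
          unfolding sum_of_rat_restrict[OF finite_weight_lists A]
          by (intro exI[of _ "\<lambda>w. if w \<in> weight_lists k (n - 1) then c w else 0"])
      qed
    qed
    then obtain c where c: "\<And>i N. i \<in> I \<Longrightarrow> N \<ge> 1 \<Longrightarrow> fps_nth (T i) N =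
       (\<Sum>w\<in>weight_lists k n. of_rat (c i w) * (mhs w N / of_nat N ^ (n - 1 - sum_list w)))"
      by metis
    have "fps_nth (\<Prod>i\<in>I. Li_fps (s i)) N =
      (\<Sum>w\<in>weight_lists k n. of_rat (\<Sum>i\<in>I. c i w) * (mhs w N / of_nat N ^ (n - sum_list w)))"
      if N: "N \<ge> 1" for N
    proof -
      have "of_nat N * fps_nth (\<Prod>i\<in>I. Li_fps (s i)) N = fps_nth (fps_XD (\<Prod>i\<in>I. Li_fps (s i))) N"
        by simp
      also have "\<dots> = (\<Sum>i\<in>I. fps_nth (T i) N)"
        unfolding T_def fps_XD_prod[OF less.prems(1)] by (simp add: fps_sum_nth)
      also have "\<dots> = (\<Sum>i\<in>I. \<Sum>w\<in>weight_lists k n. of_rat (c i w) * (mhs w N / of_nat N ^ (n - 1 - sum_list w)))"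
        by (intro sum.cong refl c N)
      also have "\<dots> = (\<Sum>w\<in>weight_lists k n. of_rat (\<Sum>i\<in>I. c i w) * (mhs w N / of_nat N ^ (n - 1 - sum_list w)))"
        by (subst sum.swap) (simp only: of_rat_sum sum_distrib_right)
      also have "\<dots> = of_nat N * (\<Sum>w\<in>weight_lists k n. of_rat (\<Sum>i\<in>I. c i w) * (mhs w N / of_nat N ^ (n - sum_list w)))"
        unfolding sum_distrib_left
      proof (intro sum.cong refl)
        fix w assume "w \<in> weight_lists k n"
        hence "n - sum_list w = Suc (n - 1 - sum_list w)" by (auto simp: weight_lists_def)
        thus "of_rat (\<Sum>i\<in>I. c i w) * (mhs w N / of_nat N ^ (n - 1 - sum_list w)) =
          of_nat N * (of_rat (\<Sum>i\<in>I. c i w) * (mhs w N / of_nat N ^ (n - sum_list w)))"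
          using N by simp
      qed
      finally show ?thesis using N by simp
    qed
    note prod_eq = this
    show ?thesis unfolding n_def[symmetric] k_def[symmetric]
      by (intro exI[of _ "\<lambda>w. \<Sum>i\<in>I. c i w"] allI impI) (rule prod_eq)
  qed
qed

subsection \<open>The series as Dirichlet series\<close>

definition monomial_at :: "nat list \<Rightarrow> nat list \<Rightarrow> complex" where
  "monomial_at s m = (\<Prod>i<length s. 1 / of_nat (m ! i) ^ (s ! i))"

lemma monomial_at_Nil [simp]: "monomial_at [] m = 1"
  by (simp add: monomial_at_def)

lemma monomial_at_Cons [simp]: "monomial_at (a # s) (x # m) = 1 / of_nat x ^ a * monomial_at s m"
  unfolding monomial_at_def by (simp add: prod.lessThan_Suc_shift del: prod.lessThan_Suc)

lemma norm_monomial_at_le: "norm (monomial_at s m) \<le> 1"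
proof -
  have "norm (1 / complex_of_nat x ^ a) \<le> 1" for x a
  proof (cases "x = 0")
    case False
    hence "1 \<le> real x ^ a" by (intro one_le_power) simp
    thus ?thesis using False by (simp add: norm_divide norm_power divide_le_eq)
  qed (cases a; simp)
  thus ?thesis
    unfolding monomial_at_def prod_norm[symmetric] by (intro prod_le_1) auto
qed

text \<open>Summation by fibres is allowed by absolute convergence: the fibre over \<open>N\<close>
  has at most N^r lists, with r the length of \<open>s\<close>, and every monomial has norm at most
  1, so the total is dominated by the sum of C N^(r - Re u).\<close>

lemma infsum_lists_dseries:
  assumes chi: "\<And>n. norm (chi n) \<le> C" "C \<ge> 0"
    and A: "\<And>N. A N \<subseteq> {m. set m \<subseteq> {1..N} \<and> length m = length s}"
    and u: "Re u > real (length s) + 1"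
  shows "(\<Sum>\<^sub>\<infinity>(N, m)\<in>Sigma {1..} A. chi N * monomial_at s m * of_nat N powr (-u)) =
           dseries (\<lambda>N. chi N * (\<Sum>m\<in>A N. monomial_at s m)) u"
proof -
  define f where "f = (\<lambda>(N, m). chi N * monomial_at s m * of_nat N powr (-u))"
  have fin: "finite (A N)" and card: "card (A N) \<le> N ^ length s" for N
  proof -
    have "finite {m. set m \<subseteq> {1..N} \<and> length m = length s}" by (rule finite_lists_length_eq) simp
    from finite_subset[OF A this] card_mono[OF this A]
    show "finite (A N)" "card (A N) \<le> N ^ length s" by (simp_all add: card_lists_length_eq)
  qed
  \<comment> \<open>The absolute values summed over a fibre, made complex so that the convergence
    criterion for Dirichlet series applies.\<close>
  define a where "a = (\<lambda>N. complex_of_real (\<Sum>m\<in>A N. norm (chi N * monomial_at s m)))"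
  have "norm (a N) \<le> C * real N ^ length s" for N
  proof -
    have "norm (a N) = (\<Sum>m\<in>A N. norm (chi N * monomial_at s m))"
      unfolding a_def norm_of_real by (intro abs_of_nonneg sum_nonneg) auto
    also have "\<dots> \<le> (\<Sum>m\<in>A N. C * 1)"
      unfolding norm_mult by (intro sum_mono mult_mono chi norm_monomial_at_le) (use chi in auto)
    also have "\<dots> \<le> C * real (N ^ length s)"
      using card[of N] chi(2) by (simp add: mult.commute[of C] mult_right_mono del: of_nat_power)
    finally show ?thesis by simp
  qed
  hence "power_bounded (length s) a" unfolding power_bounded_def by blast
  from norm_summable_dseries[OF this u]
  have "(\<lambda>N. norm (a N * of_nat N powr (-u))) summable_on UNIV"
    by (intro norm_summable_imp_summable_on) simp
  hence *: "(\<lambda>N. norm (a N * of_nat N powr (-u))) summable_on {1..}"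
    by (rule summable_on_subset_banach) simp
  have eq: "(\<Sum>\<^sub>\<infinity>m\<in>A N. norm (f (N, m))) = norm (a N * of_nat N powr (-u))" for N
  proof -
    have "(\<Sum>\<^sub>\<infinity>m\<in>A N. norm (f (N, m))) = (\<Sum>m\<in>A N. norm (chi N * monomial_at s m)) * norm (of_nat N powr (-u))"
      using fin by (simp add: f_def norm_mult sum_distrib_right)
    also have "(\<Sum>m\<in>A N. norm (chi N * monomial_at s m)) = norm (a N)"
      unfolding a_def norm_of_real by (intro abs_of_nonneg[symmetric] sum_nonneg) auto
    finally show ?thesis by (simp add: norm_mult)
  qed
  have "(\<lambda>x. norm (f x)) summable_on Sigma {1..} A"
    unfolding Infinite_Sum.abs_summable_on_Sigma_iff eq using fin * by simp
  hence summ: "f summable_on Sigma {1..} A" by (rule abs_summable_summable)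
  define b where "b = (\<lambda>N. chi N * (\<Sum>m\<in>A N. monomial_at s m))"
  have inner: "(\<Sum>\<^sub>\<infinity>m\<in>A N. f (N, m)) = b N * of_nat N powr (-u)" for N
    using fin by (simp add: f_def b_def sum_distrib_left sum_distrib_right)
  have "infsum f (Sigma {1..} A) = (\<Sum>\<^sub>\<infinity>N\<in>{1..}. b N * of_nat N powr (-u))"
    unfolding infsum_Sigma_banach[OF summ, symmetric] inner ..
  also have "\<dots> = (\<Sum>\<^sub>\<infinity>N. b N * of_nat N powr (-u))"
    by (rule infsum_cong_neutral) (auto simp: not_le)
  also have "\<dots> = dseries b u"
  proof -
    have "norm (b N * of_nat N powr (-u)) \<le> norm (a N * of_nat N powr (-u))" for N
      unfolding eq[symmetric] inner[symmetric] using fin by (simp add: norm_sum)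
    hence "summable (\<lambda>N. norm (b N * of_nat N powr (-u)))"
      using norm_summable_dseries[OF \<open>power_bounded (length s) a\<close> u]
      by (intro summable_comparison_test'[of "\<lambda>N. norm (a N * of_nat N powr (-u))" 0
         "\<lambda>N. norm (b N * of_nat N powr (-u))"]) (simp_all only: real_norm_def abs_norm_cancel)
    hence "(\<lambda>N. b N * of_nat N powr (-u)) summable_on UNIV"
      by (rule norm_summable_imp_summable_on)
    from has_sum_imp_sums[OF has_sum_infsum[OF this]] show ?thesis
      by (simp add: dseries_def sums_iff)
  qed
  finally show ?thesis unfolding f_def b_def .
qed

section \<open>The index lists of both series, fibred over the leading variable or the total\<close>

definition desc_lists :: "nat \<Rightarrow> nat \<Rightarrow> nat list set" where
  "desc_lists k N = {m. length m = k \<and> sorted_wrt (>) m \<and> (\<forall>x\<in>set m. 1 \<le> x \<and> x < N)}"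

definition comps :: "nat \<Rightarrow> nat \<Rightarrow> nat list set" where
  "comps k N = {m. length m = k \<and> (\<forall>x\<in>set m. 1 \<le> x) \<and> sum_list m = N}"

lemma desc_lists_subset: "desc_lists k N \<subseteq> {m. set m \<subseteq> {1..N} \<and> length m = k}"
  unfolding desc_lists_def by (auto simp: subset_iff)

lemma comps_subset: "comps k N \<subseteq> {m. set m \<subseteq> {1..N} \<and> length m = k}"
  unfolding comps_def using member_le_sum_list by fastforce

lemma finite_desc_lists: "finite (desc_lists k N)"
  using desc_lists_subset by (rule finite_subset) (simp add: finite_lists_length_eq)

lemma finite_comps: "finite (comps k N)"
  using comps_subset by (rule finite_subset) (simp add: finite_lists_length_eq)

lemma mhs_eq_sum: "mhs s N = (\<Sum>m\<in>desc_lists (length s) N. monomial_at s m)"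
proof (induction s arbitrary: N)
  case Nil
  have "desc_lists 0 N = {[]}" by (auto simp: desc_lists_def)
  thus ?case by simp
next
  case (Cons a s)
  have "mhs (a # s) N = (\<Sum>x=1..<N. \<Sum>m\<in>desc_lists (length s) x. monomial_at (a # s) (x # m))"
    by (simp add: Cons sum_divide_distrib)
  also have "\<dots> = (\<Sum>(x, m)\<in>(SIGMA x:{1..<N}. desc_lists (length s) x). monomial_at (a # s) (x # m))"
    by (rule sum.Sigma) (auto simp: finite_desc_lists)
  also have "\<dots> = (\<Sum>m\<in>desc_lists (length (a # s)) N. monomial_at (a # s) m)"
    by (rule sum.reindex_bij_witness[of _ "\<lambda>m. (hd m, tl m)" "\<lambda>(x, m). x # m"])
      (auto simp: desc_lists_def length_Suc_conv)
  finally show ?case .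
qed

text \<open>Splitting off the first part of a composition corresponds to the Cauchy product with the
  first polylogarithm.\<close>

lemma prod_Li_fps_eq_sum:
  "fps_nth (\<Prod>i<length s. Li_fps (s ! i)) N = (\<Sum>m\<in>comps (length s) N. monomial_at s m)"
proof (induction s arbitrary: N)
  case Nil
  have "comps 0 N = (if N = 0 then {[]} else {})" by (auto simp: comps_def)
  thus ?case by simp
next
  case (Cons a s)
  have "fps_nth (\<Prod>i<length (a # s). Li_fps ((a # s) ! i)) N =
      fps_nth (Li_fps a * (\<Prod>i<length s. Li_fps (s ! i))) N"
    by (simp add: prod.lessThan_Suc_shift del: prod.lessThan_Suc)
  also have "\<dots> = (\<Sum>x=0..N. fps_nth (Li_fps a) x * (\<Sum>m\<in>comps (length s) (N - x). monomial_at s m))"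
    unfolding fps_mult_nth Cons ..
  also have "\<dots> = (\<Sum>x=1..N. 1 / of_nat x ^ a * (\<Sum>m\<in>comps (length s) (N - x). monomial_at s m))"
    by (rule sum.mono_neutral_cong_right) (auto simp: Li_fps_def)
  also have "\<dots> = (\<Sum>x=1..N. \<Sum>m\<in>comps (length s) (N - x). monomial_at (a # s) (x # m))"
    by (simp add: sum_distrib_left sum_divide_distrib)
  also have "\<dots> = (\<Sum>(x, m)\<in>(SIGMA x:{1..N}. comps (length s) (N - x)). monomial_at (a # s) (x # m))"
    by (rule sum.Sigma) (auto simp: finite_comps)
  also have "\<dots> = (\<Sum>m\<in>comps (length (a # s)) N. monomial_at (a # s) m)"
    by (rule sum.reindex_bij_witness[of _ "\<lambda>m. (hd m, tl m)" "\<lambda>(x, m). x # m"])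
      (auto simp: comps_def length_Suc_conv)
  finally show ?case .
qed

lemma MLV_series_eq_dseries:
  assumes chi: "\<And>n. norm (chi n) \<le> C" "C \<ge> 0" and u: "Re u > real (length w) + 1"
  shows "MLV_series (u # map of_nat w) (chi # replicate (length w) principal_char) =
     dseries (\<lambda>N. chi N * mhs w N) u"
proof -
  let ?k = "length w"
  let ?M = "{m :: nat list. length m = Suc ?k \<and> sorted_wrt (>) m \<and> (\<forall>i < length m. m ! i \<ge> 1)}"
  define h where "h = (\<lambda>m. \<Prod>j<length m. ((chi # replicate ?k principal_char) ! j) (m ! j) /
      of_nat (m ! j) powr ((u # map of_nat w) ! j))"
  have M: "?M = {m. length m = Suc ?k \<and> sorted_wrt (>) m \<and> (\<forall>x\<in>set m. x \<ge> 1)}"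
    by (auto simp: all_set_conv_all_nth)
  have bij: "bij_betw (\<lambda>(N, m). N # m) (Sigma {1..} (desc_lists ?k)) ?M"
    unfolding M by (rule bij_betw_byWitness[where f' = "\<lambda>m. (hd m, tl m)"])
      (auto simp: desc_lists_def length_Suc_conv)
  have "MLV_series (u # map of_nat w) (chi # replicate ?k principal_char) = infsum h ?M"
    unfolding MLV_series_def h_def by simp
  also have "\<dots> = (\<Sum>\<^sub>\<infinity>x\<in>Sigma {1..} (desc_lists ?k). h ((\<lambda>(N, m). N # m) x))"
    by (rule infsum_reindex_bij_betw[OF bij, symmetric])
  also have "\<dots> = (\<Sum>\<^sub>\<infinity>(N, m)\<in>Sigma {1..} (desc_lists ?k). chi N * monomial_at w m * of_nat N powr (-u))"
  proof (rule infsum_cong, clarify)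
    fix N m assume N: "1 \<le> N" and m: "m \<in> desc_lists ?k N"
    hence len: "length m = ?k" and pos: "\<And>j. j < ?k \<Longrightarrow> m ! j \<ge> 1"
      by (auto simp: desc_lists_def)
    have "h (N # m) = chi N / of_nat N powr u *
        (\<Prod>j<?k. (replicate ?k principal_char ! j) (m ! j) / of_nat (m ! j) powr (map of_nat w ! j))"
      unfolding h_def using len by (simp add: prod.lessThan_Suc_shift del: prod.lessThan_Suc)
    also have "(\<Prod>j<?k. (replicate ?k principal_char ! j) (m ! j) / of_nat (m ! j) powr (map of_nat w ! j))
       = monomial_at w m"
      unfolding monomial_at_def
    proof (rule prod.cong)
      fix j assume "j \<in> {..<?k}"
      thus "(replicate ?k principal_char ! j) (m ! j) / complex_of_nat (m ! j) powr (map of_nat w ! j)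
          = 1 / of_nat (m ! j) ^ (w ! j)"
        using pos[of j] by (simp add: principal_char_def powr_nat')
    qed simp
    finally show "h (N # m) = chi N * monomial_at w m * of_nat N powr (-u)"
      by (simp add: powr_minus field_simps)
  qed
  also have "\<dots> = dseries (\<lambda>N. chi N * mhs w N) u"
    unfolding mhs_eq_sum by (rule infsum_lists_dseries[OF chi desc_lists_subset u])
  finally show ?thesis .
qed

text \<open>The index lists are fibred by their sum. Nonemptiness of \<open>s\<close> makes every
  sum at least 1, so the fibres over \<open>{1..}\<close> exhaust them.\<close>

lemma MTLV_series_eq_dseries:
  assumes chi: "\<And>n. norm (chi n) \<le> C" "C \<ge> 0" and u: "Re u > real (length s) + 1"
    and s: "s \<noteq> []"
  shows "MTLV_series (map of_nat s @ [u]) (replicate (length s) principal_char @ [chi]) =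
     dseries (\<lambda>N. chi N * fps_nth (\<Prod>i<length s. Li_fps (s ! i)) N) u"
proof -
  let ?k = "length s"
  let ?M = "{m :: nat list. length m = ?k \<and> (\<forall>i < length m. m ! i \<ge> 1)}"
  define h where "h = (\<lambda>m. (\<Prod>i<length m. ((replicate ?k principal_char @ [chi]) ! i) (m ! i) /
      of_nat (m ! i) powr ((map of_nat s @ [u]) ! i)) * (chi (sum_list m) / of_nat (sum_list m) powr u))"
  have pos_sum: "sum_list m \<ge> 1" if "m \<in> ?M" for m
  proof -
    have "m \<noteq> []" using that s by auto
    hence "m ! 0 \<ge> 1" "m ! 0 \<in> set m" using that s nth_mem[of 0 m] by auto
    thus ?thesis using member_le_sum_list[of "m ! 0" m] by linarith
  qed
  have bij: "bij_betw snd (Sigma {1..} (comps ?k)) ?M"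
    by (rule bij_betw_byWitness[where f' = "\<lambda>m. (sum_list m, m)"])
      (use pos_sum in \<open>auto simp: comps_def all_set_conv_all_nth\<close>)
  have "MTLV_series (map of_nat s @ [u]) (replicate ?k principal_char @ [chi]) = infsum h ?M"
    unfolding MTLV_series_def h_def by simp
  also have "\<dots> = (\<Sum>\<^sub>\<infinity>x\<in>Sigma {1..} (comps ?k). h (snd x))"
    by (rule infsum_reindex_bij_betw[OF bij, symmetric])
  also have "\<dots> = (\<Sum>\<^sub>\<infinity>(N, m)\<in>Sigma {1..} (comps ?k). chi N * monomial_at s m * of_nat N powr (-u))"
  proof (rule infsum_cong, clarify)
    fix N m assume N: "1 \<le> N" and m: "m \<in> comps ?k N"
    hence len: "length m = ?k" and pos: "\<And>j. j < ?k \<Longrightarrow> m ! j \<ge> 1" and sm: "sum_list m = N"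
      by (auto simp: comps_def)
    have "(\<Prod>i<length m. ((replicate ?k principal_char @ [chi]) ! i) (m ! i) /
      of_nat (m ! i) powr ((map of_nat s @ [u]) ! i)) = monomial_at s m"
      unfolding monomial_at_def len
    proof (rule prod.cong)
      fix i assume "i \<in> {..<?k}"
      thus "((replicate ?k principal_char @ [chi]) ! i) (m ! i) / complex_of_nat (m ! i) powr ((map of_nat s @ [u]) ! i)
          = 1 / of_nat (m ! i) ^ (s ! i)"
        using pos[of i] by (simp add: principal_char_def powr_nat' nth_append)
    qed simp
    thus "h (snd (N, m)) = chi N * monomial_at s m * of_nat N powr (-u)"
      by (simp add: h_def sm powr_minus field_simps)
  qed
  also have "\<dots> = dseries (\<lambda>N. chi N * fps_nth (\<Prod>i<length s. Li_fps (s ! i)) N) u"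
    unfolding prod_Li_fps_eq_sum by (rule infsum_lists_dseries[OF chi comps_subset u])
  finally show ?thesis .
qed

section \<open>From the coefficient identity to special values\<close>

lemma special_MLV_periodic:
  fixes chi :: "nat \<Rightarrow> complex" and w :: "nat list"
  assumes chi: "\<And>n. chi (n + q) = chi n" "q > 0"
  defines "E \<equiv> \<lambda>u. special_MLV u w (chi # replicate (length w) principal_char)"
  shows "E nicely_meromorphic_on UNIV"
    "\<exists>\<sigma>. \<forall>u. Re u > \<sigma> \<longrightarrow> E u = dseries (\<lambda>N. chi N * mhs w N) u"
proof -
  obtain C where C: "\<And>n. norm (chi n) \<le> C" "C \<ge> 0"
    using periodic_bounded[of chi, OF chi] by blast
  define F where "F = (\<lambda>u. MLV_series (u # map of_nat w) (chi # replicate (length w) principal_char))"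
  have E: "E = mero_continuation F"
    unfolding E_def F_def special_MLV_def ..
  have F: "F u = dseries (\<lambda>N. chi N * mhs w N) u" if "Re u > real (length w) + 1" for u
    unfolding F_def by (rule MLV_series_eq_dseries[OF C that])
  note mc = mero_continuation_dseries[OF merom_dseries_periodic_mhs[of chi, OF chi]
      power_bounded_periodic_mhs[of chi, OF chi] F]
  show "E nicely_meromorphic_on UNIV" unfolding E by (rule mc(1))
  obtain \<tau> where "\<And>u. Re u > \<tau> \<Longrightarrow> E u = F u" using mc(2) unfolding E by blast
  hence "\<forall>u. Re u > max \<tau> (real (length w) + 1) \<longrightarrow> E u = dseries (\<lambda>N. chi N * mhs w N) u"
    using F by auto
  thus "\<exists>\<sigma>. \<forall>u. Re u > \<sigma> \<longrightarrow> E u = dseries (\<lambda>N. chi N * mhs w N) u" by blast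
qed

text \<open>Dividing the coefficient by N^(n - sum of \<open>w\<close>) moves the argument to the
  right by that exponent, which keeps the total weight and does not hurt convergence.\<close>

lemma dseries_prod_Li_fps:
  assumes chi: "\<And>n. chi (n + q) = chi n" "q > 0"
    and c: "\<And>N. N \<ge> 1 \<Longrightarrow> P N =
       (\<Sum>w\<in>W. of_rat (c w) * (mhs w N / of_nat N ^ (n - sum_list w)))"
    and W: "\<And>w. w \<in> W \<Longrightarrow> length w = k \<and> sum_list w \<le> n"
    and u: "Re u > real k + 1"
  shows "dseries (\<lambda>N. chi N * P N) u =
     (\<Sum>w\<in>W. of_rat (c w) * dseries (\<lambda>N. chi N * mhs w N) (u + of_nat n - of_nat (sum_list w)))"
proof -
  have term_eq: "chi N * P N * of_nat N powr (-u) = (\<Sum>w\<in>W. of_rat (c w) *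
      (chi N * mhs w N * of_nat N powr (-(u + of_nat n - of_nat (sum_list w)))))" for N
  proof (cases "N = 0")
    case False
    have "of_nat N powr (-(u + of_nat n - of_nat (sum_list w))) =
        of_nat N powr (-u) / of_nat N ^ (n - sum_list w)" if "w \<in> W" for w
    proof -
      have "-(u + of_nat n - of_nat (sum_list w)) = -u - of_nat (n - sum_list w)"
        using W[OF that] by (simp add: of_nat_diff)
      thus ?thesis using False by (simp only: powr_diff) (simp add: powr_nat')
    qed
    thus ?thesis
      using False by (simp add: c sum_distrib_left sum_distrib_right mult_ac)
  qed simp
  have "(\<lambda>N. chi N * P N * of_nat N powr (-u)) sums (\<Sum>w\<in>W. of_rat (c w) *
      dseries (\<lambda>N. chi N * mhs w N) (u + of_nat n - of_nat (sum_list w)))"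
    unfolding term_eq
  proof (intro sums_sum sums_mult dseries_sums)
    fix w assume w: "w \<in> W"
    show "power_bounded (length w) (\<lambda>N. chi N * mhs w N)"
      by (rule power_bounded_periodic_mhs[of chi, OF chi])
    show "Re (u + of_nat n - of_nat (sum_list w)) > real (length w) + 1"
      using W[OF w] u by simp
  qed
  thus ?thesis by (simp add: dseries_def sums_iff)
qed

(* W consists of tails (w_2, ..., w_k); equality of weights forces the leading exponent to be
   z + (s_1 + ... + s_k) - (w_2 + ... + w_k). The values are those of meromorphic functions of z:
   the identity holds for these functions near z, and at z itself when no term has a pole there. *)
theorem theorem3p1:
  fixes k q :: nat and z :: complex and s :: "nat list" and chi :: "nat \<Rightarrow> complex"
  assumes "k \<ge> 2"
    and "length s = k" and "\<forall>i < k. s ! i \<ge> 1"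
    and "primitive_dirichlet_char q chi"
  shows "\<exists>(W :: nat list set) (c :: nat list \<Rightarrow> rat).
    finite W \<and> (\<forall>w\<in>W. length w = k - 1 \<and> (\<forall>j < k - 1. w ! j \<ge> 1)) \<and>
    (let G = (\<lambda>u. special_MTLV s u (replicate k principal_char @ [chi]));
         F = (\<lambda>w u. special_MLV (u + of_nat (sum_list s) - of_nat (sum_list w)) w
                        (chi # replicate (k - 1) principal_char))
     in (\<forall>\<^sub>F u in at z. G u = (\<Sum>w\<in>W. of_rat (c w) * F w u)) \<and>
        ((\<forall>w\<in>W. \<not> is_pole (F w) z) \<longrightarrow>
           \<not> is_pole G z \<and> G z = (\<Sum>w\<in>W. of_rat (c w) * F w z)))"
proof -
  have chi: "\<And>n. chi (n + q) = chi n" "q > 0"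
    using assms(4) unfolding primitive_dirichlet_char_def dirichlet_char_def by blast+
  obtain C where C: "\<And>n. norm (chi n) \<le> C" "C \<ge> 0"
    using periodic_bounded[of chi, OF chi] by blast
  define n where "n = sum_list s"
  have n: "n = (\<Sum>i<k. s ! i)"
    unfolding n_def sum_list_sum_nth assms(2) by (simp add: atLeast0LessThan)
  define W where "W = weight_lists (k - 1) n"
  have finW: "finite W" unfolding W_def by (rule finite_weight_lists)
  have W: "length w = k - 1" "\<forall>j<k - 1. w ! j \<ge> 1" "sum_list w \<le> n" if "w \<in> W" for w
    using that by (auto simp: W_def weight_lists_def all_set_conv_all_nth)
  define P where "P = fps_nth (\<Prod>i<k. Li_fps (s ! i))"
  obtain c where c: "\<forall>N\<ge>1. P N = (\<Sum>w\<in>W. of_rat (c w) * (mhs w N / of_nat N ^ (n - sum_list w)))"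
  proof -
    have "{..<k} \<noteq> {}" using assms(1) by (auto simp: lessThan_empty_iff)
    from prod_Li_fps_mhs[OF finite_lessThan this, of "\<lambda>i. s ! i"] assms(3) show ?thesis
      using that unfolding P_def W_def n card_lessThan by blast
  qed
  define E where "E = (\<lambda>w u. special_MLV u w (chi # replicate (k - 1) principal_char))"
  define F where "F = (\<lambda>w u. E w (u + of_nat n - of_nat (sum_list w)))"
  define H where "H = (\<lambda>u. \<Sum>w\<in>W. of_rat (c w) * F w u)"
  define S where "S = (\<lambda>u. MTLV_series (map of_nat s @ [u]) (replicate k principal_char @ [chi]))"
  have E: "E w nicely_meromorphic_on UNIV"
    "\<exists>\<sigma>. \<forall>u. Re u > \<sigma> \<longrightarrow> E w u = dseries (\<lambda>N. chi N * mhs w N) u" if "w \<in> W" for w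
    using special_MLV_periodic[of chi q w, OF chi] W(1)[OF that] unfolding E_def by auto
  \<comment> \<open>\<open>W\<close> is finite, so the sum of the absolute values of the individual
    bounds serves for all \<open>w\<close> at once.\<close>
  have "\<exists>\<sigma>. \<forall>w\<in>W. \<forall>u. Re u > \<sigma> \<longrightarrow> E w u = dseries (\<lambda>N. chi N * mhs w N) u"
  proof -
    obtain \<sigma> where \<sigma>: "\<And>w u. w \<in> W \<Longrightarrow> Re u > \<sigma> w \<Longrightarrow> E w u = dseries (\<lambda>N. chi N * mhs w N) u"
      using E(2) by metis
    have "\<sigma> w \<le> (\<Sum>w\<in>W. \<bar>\<sigma> w\<bar>)" if "w \<in> W" for w
      using member_le_sum[of w W "\<lambda>w. \<bar>\<sigma> w\<bar>"] that finW by auto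
    thus ?thesis using \<sigma> by (meson le_less_trans)
  qed
  then obtain \<sigma> where \<sigma>: "\<And>w u. w \<in> W \<Longrightarrow> Re u > \<sigma> \<Longrightarrow> E w u = dseries (\<lambda>N. chi N * mhs w N) u"
    by blast
  have "s \<noteq> []" using assms(1,2) by auto
  hence S: "S u = dseries (\<lambda>N. chi N * P N) u" if "Re u > real k + 1" for u
    unfolding S_def P_def using MTLV_series_eq_dseries[of chi C s u] C assms that by auto
  have S_sum: "S u = (\<Sum>w\<in>W. of_rat (c w) *
      dseries (\<lambda>N. chi N * mhs w N) (u + of_nat n - of_nat (sum_list w)))"
    if u: "Re u > real k + 1" for u
    unfolding S[OF u]
    by (rule dseries_prod_Li_fps[where chi = chi and P = P and W = W and c = c and n = n and k = "k - 1", OF chi]) (use c W u in auto)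
  have H_eq: "H u = S u" if u: "Re u > max \<sigma> (real k + 1)" for u
  proof -
    have "S u =
       (\<Sum>w\<in>W. of_rat (c w) * dseries (\<lambda>N. chi N * mhs w N) (u + of_nat n - of_nat (sum_list w)))"
      by (rule S_sum) (use u in simp)
    also have "\<dots> = H u"
      unfolding H_def F_def
    proof (intro sum.cong refl)
      fix w assume w: "w \<in> W"
      have "Re (u + of_nat n - of_nat (sum_list w)) > \<sigma>" using u W(3)[OF w] by simp
      from \<sigma>[OF w this] show "of_rat (c w) * dseries (\<lambda>N. chi N * mhs w N) (u + of_nat n - of_nat (sum_list w))
          = of_rat (c w) * E w (u + of_nat n - of_nat (sum_list w))" by simp
    qed
    finally show ?thesis ..
  qed
  have H_mero: "H meromorphic_on UNIV"
    unfolding H_def F_def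
  proof (intro meromorphic_intros)
    fix w assume w: "w \<in> W"
    have "E w meromorphic_on UNIV" using E(1)[OF w] unfolding nicely_meromorphic_on_def by blast
    thus "(\<lambda>u. E w (u + of_nat n - of_nat (sum_list w))) meromorphic_on UNIV"
      by (rule meromorphic_on_compose) (auto intro!: analytic_intros)
  qed
  have S_hol: "S holomorphic_on {u. Re u > real k + 1}"
  proof (rule holomorphic_transform)
    show "(\<lambda>u. \<Sum>w\<in>W. of_rat (c w) * dseries (\<lambda>N. chi N * mhs w N)
        (u + of_nat n - of_nat (sum_list w))) holomorphic_on {u. Re u > real k + 1}"
    proof (intro holomorphic_intros)
      fix w assume w: "w \<in> W"
      have "dseries (\<lambda>N. chi N * mhs w N) holomorphic_on {u. Re u > real (length w) + 1}"
        by (rule dseries_holomorphic[OF power_bounded_periodic_mhs[of chi, OF chi]])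
      from holomorphic_on_compose_gen[OF _ this,
          of "\<lambda>u. u + of_nat n - of_nat (sum_list w)" "{u. Re u > real k + 1}"]
      show "(\<lambda>u. dseries (\<lambda>N. chi N * mhs w N) (u + of_nat n - of_nat (sum_list w)))
          holomorphic_on {u. Re u > real k + 1}"
        using W(1,3)[OF w] by (fastforce simp: o_def intro!: holomorphic_intros)
    qed
  qed (simp add: S_sum)
  \<comment> \<open>A sum of nicely meromorphic functions need not be nicely meromorphic, since
    poles of several terms may cancel or a term with a pole contributes the value 0. The
    continuation is therefore \<open>remove_sings H\<close> and not \<open>H\<close>.\<close>
  have G_eq: "special_MTLV s u (replicate k principal_char @ [chi]) = remove_sings H u" for u
  proof -
    define \<tau> where "\<tau> = max \<sigma> (real k + 1)"
    have *: "remove_sings H u = S u" if "Re u > max \<tau> (real k + 1)" for u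
      by (rule remove_sings_eq_holomorphic[where r = \<tau>, OF _ S_hol that])
        (rule H_eq[folded \<tau>_def])
    have "mero_continuation S = remove_sings H"
      by (rule mero_continuation_eqI[OF remove_sings_nicely_meromorphic[OF H_mero]]) (rule *)
    thus ?thesis unfolding special_MTLV_def S_def by simp
  qed
  have ev: "\<forall>\<^sub>F u in at z. remove_sings H u = H u"
    using H_mero by (intro eventually_remove_sings_eq_at meromorphic_on_isolated_singularity)
       (auto intro: meromorphic_on_subset)
  \<comment> \<open>A nicely meromorphic function without a pole at a point is analytic there. Hence
    \<open>H\<close> is analytic at \<open>z\<close>, and removing singularities leaves its value
    unchanged.\<close>
  have nonpole: "\<not> is_pole (remove_sings H) z \<and> remove_sings H z = H z"
    if np: "\<forall>w\<in>W. \<not> is_pole (F w) z"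
  proof -
    have "F w analytic_on {z}" if w: "w \<in> W" for w
    proof -
      have "F w = E w \<circ> (+) (of_nat n - of_nat (sum_list w))"
        by (auto simp: F_def fun_eq_iff algebra_simps)
      hence "\<not> is_pole (E w) (z + (of_nat n - of_nat (sum_list w)))"
        using np w by (metis is_pole_shift_iff)
      hence "E w analytic_on {z + (of_nat n - of_nat (sum_list w))}"
        by (intro nicely_meromorphic_on_imp_analytic_at[OF E(1)[OF w]]) auto
      hence "(E w \<circ> (\<lambda>u. u + of_nat n - of_nat (sum_list w))) analytic_on {z}"
        by (intro analytic_on_compose_gen[where T = "{z + (of_nat n - of_nat (sum_list w))}"])
          (auto intro!: analytic_intros)
      thus ?thesis by (simp add: F_def o_def)
    qed
    hence H_an: "H analytic_on {z}"
      unfolding H_def by (intro analytic_intros) auto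
    moreover have "\<not> is_pole (remove_sings H) z \<longleftrightarrow> \<not> is_pole H z"
      using is_pole_cong[OF ev refl] by simp
    ultimately show ?thesis using analytic_at_imp_no_pole by auto
  qed
  show ?thesis
    unfolding Let_def n_def[symmetric] G_eq
    using finW W(1,2) ev nonpole
    unfolding H_def F_def E_def
    by (intro exI[of _ W] exI[of _ c] conjI) blast+
qed

end
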